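(* Let $\alpha>0$, $n\in\mathbb N$, let $P_j$ be polynomials of degree $d_j=\deg P_j$, and let $p_j(x)=P_j(x^\alpha)$, $j\in\{0,\dots,n-1\}$. Suppose that $p_0\not\equiv0$ and $$\max_{0\le k\le n-1}\frac{d_k}{n-k}=\frac{d_0}{n}.$$ Then every non-trivial $\alpha$-analytic solution $y$ of the equation $$\mathbb D_\alpha^{n}y+p_{n-1}(x)\mathbb D_\alpha^{n-1}y+\dots+p_1(x)\mathbb D_\alpha y+p_0(x)y=0$$ has the form $y(t)=f(t^\alpha)$, $t\ge0$, where $f$ is an entire function whose order equals $\frac1\alpha\left(1+\frac{d_0}{n}\right)$.
   Context: A function $u$ is $\alpha$-analytic (here on $[0,\infty)$) if $u(t)=\sum_{m=0}^\infty u_mt^{\alpha m}$ with the series converging for all $t\ge0$. Non-trivial means not identically zero. The degree of the zero polynomial is taken to be $-\infty$. $\mathbb D_\alpha$ is the Caputo-Djrbashian fractional derivative of order $\alpha$: for $l-1<\alpha\le l$, $l\in\mathbb N$, $$(\mathbb D_\alpha\varphi)(x)=D^\alpha\Big(\varphi(x)-\sum_{k=0}^{l-1}\frac{\varphi^{(k)}(0)}{k!}x^k\Big),$$ where $D^\alpha\varphi=\frac{d^l}{dx^l}I^{l-\alpha}\varphi$ is the Riemann-Liouville derivative, $I^{\beta}\varphi(x)=\frac1{\Gamma(\beta)}\int_0^x(x-t)^{\beta-1}\varphi(t)\,dt$ for $\beta>0$, and $I^0\varphi=\varphi$. $\mathbb D_\alpha^{j}$ denotes the $j$-th iterate of $\mathbb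 D_\alpha$. On an $\alpha$-analytic function $u(t)=\sum_{m\ge0}u_mt^{\alpha m}$ it acts termwise: $$(\mathbb D_\alpha^{j}u)(t)=\sum_{m=0}^\infty u_{m+j}\frac{\Gamma((m+j)\alpha+1)}{\Gamma(m\alpha+1)}t^{\alpha m}.$$ The order of a non-constant entire function $f$ is $\limsup_{r\to\infty}\frac{\log\log M(r,f)}{\log r}$, where $M(r,f)=\max\{|f(z)|:|z|=r\}$. *)

theory Defs
  imports "HOL-Analysis.Analysis"
begin

text \<open>
  Functions on \<open>[0,\<infinity>)\<close> are represented as total functions on the reals whose values at
  negative arguments are irrelevant; derivatives are taken within \<open>[0,\<infinity>)\<close>, i.e. they are
  one-sided at \<open>0\<close>.
\<close>

definition half_line_deriv :: "(real \<Rightarrow> complex) \<Rightarrow> real \<Rightarrow> complex" where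
  "half_line_deriv \<phi> x = vector_derivative \<phi> (at x within {0..})"

definition frac_integral :: "real \<Rightarrow> (real \<Rightarrow> complex) \<Rightarrow> real \<Rightarrow> complex" where
  "frac_integral \<beta> \<phi> x =
     (if \<beta> = 0 then \<phi> x
      else (1 / Gamma \<beta>) *\<^sub>R (LINT t:{0..x}|lebesgue. ((x - t) powr (\<beta> - 1)) *\<^sub>R \<phi> t))"

text \<open>For \<open>\<alpha> > 0\<close>, the number \<open>l = nat \<lceil>\<alpha>\<rceil>\<close> is the unique one with \<open>l - 1 < \<alpha> \<le> l\<close>.\<close>

definition riemann_liouville_deriv :: "real \<Rightarrow> (real \<Rightarrow> complex) \<Rightarrow> real \<Rightarrow> complex" where
  "riemann_liouville_deriv \<alpha> \<phi> =
     (let l = nat \<lceil>\<alpha>\<rceil> in (half_line_deriv ^^ l) (frac_integral (real l - \<alpha>) \<phi>))"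

definition caputo_deriv :: "real \<Rightarrow> (real \<Rightarrow> complex) \<Rightarrow> real \<Rightarrow> complex" where
  "caputo_deriv \<alpha> \<phi> =
     riemann_liouville_deriv \<alpha>
       (\<lambda>x. \<phi> x - (\<Sum>k<nat \<lceil>\<alpha>\<rceil>. (half_line_deriv ^^ k) \<phi> 0 / fact k * of_real x ^ k))"

text \<open>
  The powers \<open>t\<^bsup>\<alpha>m\<^esup>\<close> are written \<open>(t powr \<alpha>) ^ m\<close> because \<open>0 powr 0 = 0\<close>, whereas the term
  for \<open>m = 0\<close> has to be the constant \<open>u 0\<close> also at \<open>t = 0\<close>.
\<close>

definition frac_analytic :: "real \<Rightarrow> (real \<Rightarrow> complex) \<Rightarrow> bool" where
  "frac_analytic \<alpha> y \<longleftrightarrow>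
     (\<exists>u :: nat \<Rightarrow> complex. \<forall>t\<ge>0. (\<lambda>m. u m * of_real ((t powr \<alpha>) ^ m)) sums y t)"

text \<open>The polynomial degree, with the convention that the zero polynomial has degree \<open>-\<infinity>\<close>.\<close>

definition ext_degree :: "complex poly \<Rightarrow> ereal" where
  "ext_degree P = (if P = 0 then -\<infinity> else ereal (real (degree P)))"

definition max_modulus :: "real \<Rightarrow> (complex \<Rightarrow> complex) \<Rightarrow> real" where
  "max_modulus r f = (SUP z\<in>sphere 0 r. norm (f z))"

text \<open>
  Only meaningful for non-constant entire \<open>f\<close>; then \<open>max_modulus r f\<close> tends to infinity, so
  that both logarithms are eventually applied to positive arguments.
\<close>

definition entire_order :: "(complex \<Rightarrow> complex) \<Rightarrow> ereal" where
  "entire_order f = Limsup at_top (\<lambda>r. ereal (ln (ln (max_modulus r f)) / ln r))"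

end

theory Submission
  imports Defs "HOL-Complex_Analysis.Complex_Analysis" "HOL-Real_Asymp.Real_Asymp"
begin

text \<open>
  Write \<open>y t = f (t powr \<alpha>)\<close> with \<open>f z = (\<Sum>m. u m * z ^ m)\<close> and \<open>q = \<alpha> / (1 + d\<^sub>0 / n)\<close>. Since the
  Caputo derivative acts termwise, the equation becomes a linear recurrence for the \<open>u m\<close> whose
  coefficients are quotients of Gamma values, which log-convexity of Gamma compares with powers.
  Solved for the highest index, the recurrence shows that \<open>norm (u m) * fact m powr q\<close> grows at most
  geometrically, so the order is at most \<open>1 / q\<close>. If the order were smaller, Cauchy's estimate would
  bound \<open>a m = norm (u m) * fact m powr \<tau>\<close> for some \<open>\<tau> > q\<close>. But the recurrence can also be
  solved for the term carrying the leading coefficient of \<open>P 0\<close>, which bounds \<open>a k\<close> by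
  \<open>C * (k + 1) powr (q - \<tau>)\<close> times the supremum of the later \<open>a m\<close>. This is a contraction for large
  \<open>k\<close> and forces \<open>u = 0\<close>.
\<close>

section \<open>Power bounds for quotients of Gamma values\<close>

text \<open>By log-convexity the chord slope of \<open>ln \<circ> Gamma\<close> over [x, x + s] is
  at most the slope over [x + s, x + s + 1], which the functional equation evaluates to
  \<open>ln (x + s)\<close>.\<close>

lemma Gamma_ratio_upper:
  fixes x s :: real
  assumes "x > 0" "s \<ge> 0"
  shows "Gamma (x + s) / Gamma x \<le> (x + s) powr s"
proof (cases "s = 0")
  case True
  with assms Gamma_real_pos[of x] show ?thesis by simp
next
  case False
  with assms have s: "s > 0" by simp
  let ?L = "ln \<circ> (Gamma :: real \<Rightarrow> real)"
  have pos: "Gamma x > 0" "Gamma (x + s) > 0" "Gamma (x + s + 1) > 0"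
    using assms by (auto intro!: Gamma_real_pos)
  have rec: "Gamma (x + s + 1) = (x + s) * Gamma (x + s)"
    using assms by (intro Gamma_plus1) (auto elim!: nonpos_Ints_cases)
  have "(?L x - ?L (x + s)) / (x - (x + s)) \<le> (?L x - ?L (x + s + 1)) / (x - (x + s + 1))"
    using assms s by (intro convex_on_slope_le(1)[OF log_convex_Gamma_real]) auto
  also have "\<dots> \<le> (?L (x + s) - ?L (x + s + 1)) / (x + s - (x + s + 1))"
    using assms s by (intro convex_on_slope_le(2)[OF log_convex_Gamma_real]) auto
  finally have "ln (Gamma (x + s)) - ln (Gamma x) \<le> s * (ln (Gamma (x + s + 1)) - ln (Gamma (x + s)))"
    using s by (simp add: field_simps)
  also have "ln (Gamma (x + s + 1)) - ln (Gamma (x + s)) = ln (x + s)"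
    unfolding rec using pos(2) assms s by (subst ln_mult_pos) auto
  finally have "ln (Gamma (x + s) / Gamma x) \<le> s * ln (x + s)"
    using pos by (simp add: ln_div)
  hence "exp (ln (Gamma (x + s) / Gamma x)) \<le> exp (s * ln (x + s))" by (simp only: exp_le_cancel_iff)
  thus ?thesis using pos assms s by (simp add: powr_def mult.commute)
qed

text \<open>The mirror image: the comparison chord lies over [x - 1, x] and has slope
  \<open>ln (x - 1)\<close>; \<open>x > 1\<close> keeps its left end in the domain of
  log-convexity.\<close>

lemma Gamma_ratio_lower:
  fixes x s :: real
  assumes "x > 1" "s \<ge> 0"
  shows "(x - 1) powr s \<le> Gamma (x + s) / Gamma x"
proof (cases "s = 0")
  case True
  moreover have "Gamma x \<noteq> 0" using assms Gamma_real_pos[of x] by (metis less_irrefl less_trans zero_less_one)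
  ultimately show ?thesis using assms by simp
next
  case False
  with assms have s: "s > 0" by simp
  let ?L = "ln \<circ> (Gamma :: real \<Rightarrow> real)"
  have pos: "Gamma x > 0" "Gamma (x + s) > 0" "Gamma (x - 1) > 0"
    using assms by (auto intro!: Gamma_real_pos)
  have "Gamma ((x - 1) + 1) = (x - 1) * Gamma (x - 1)"
    using assms by (intro Gamma_plus1) (auto elim!: nonpos_Ints_cases)
  hence rec: "Gamma x = (x - 1) * Gamma (x - 1)" by simp
  have "(?L (x - 1) - ?L x) / (x - 1 - x) \<le> (?L (x - 1) - ?L (x + s)) / (x - 1 - (x + s))"
    using assms s by (intro convex_on_slope_le(1)[OF log_convex_Gamma_real]) auto
  also have "\<dots> \<le> (?L x - ?L (x + s)) / (x - (x + s))"
    using assms s by (intro convex_on_slope_le(2)[OF log_convex_Gamma_real]) auto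
  finally have "s * (ln (Gamma x) - ln (Gamma (x - 1))) \<le> ln (Gamma (x + s)) - ln (Gamma x)"
    using s by (simp add: field_simps)
  also have "ln (Gamma x) - ln (Gamma (x - 1)) = ln (x - 1)"
    unfolding rec using pos(3) assms s by (subst ln_mult_pos) auto
  finally have "s * ln (x - 1) \<le> ln (Gamma (x + s) / Gamma x)"
    using pos by (simp add: ln_div)
  hence "exp (s * ln (x - 1)) \<le> exp (ln (Gamma (x + s) / Gamma x))" by (simp only: exp_le_cancel_iff)
  thus ?thesis using pos assms s by (simp add: powr_def mult.commute)
qed

section \<open>Formal power series with infinite radius of convergence\<close>

lemma fps_conv_radius_infinity_add:
  fixes F G :: "'a :: {banach, real_normed_div_algebra} fps"
  assumes "fps_conv_radius F = \<infinity>" "fps_conv_radius G = \<infinity>"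
  shows "fps_conv_radius (F + G) = \<infinity>"
  using fps_conv_radius_add[of F G] assms by simp

lemma fps_conv_radius_infinity_mult:
  fixes F G :: "'a :: {banach, real_normed_field} fps"
  assumes "fps_conv_radius F = \<infinity>" "fps_conv_radius G = \<infinity>"
  shows "fps_conv_radius (F * G) = \<infinity>"
  using fps_conv_radius_mult[of F G] assms by simp

lemma fps_conv_radius_infinity_deriv:
  fixes F :: "'a :: {banach, real_normed_field} fps"
  assumes "fps_conv_radius F = \<infinity>"
  shows "fps_conv_radius (fps_deriv F) = \<infinity>"
  using fps_conv_radius_deriv[of F] assms by simp

lemma fps_conv_radius_infinity_sum:
  fixes F :: "'b \<Rightarrow> 'a :: {banach, real_normed_field} fps"
  assumes "\<And>j. j \<in> A \<Longrightarrow> fps_conv_radius (F j) = \<infinity>"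
  shows "fps_conv_radius (\<Sum>j\<in>A. F j) = \<infinity>"
  using assms by (induction A rule: infinite_finite_induct) (auto intro!: fps_conv_radius_infinity_add)

lemma eval_fps_sum_entire:
  fixes F :: "'b \<Rightarrow> 'a :: {banach, real_normed_field} fps"
  assumes "\<And>j. j \<in> A \<Longrightarrow> fps_conv_radius (F j) = \<infinity>"
  shows "eval_fps (\<Sum>j\<in>A. F j) z = (\<Sum>j\<in>A. eval_fps (F j) z)"
  using assms
  by (induction A rule: infinite_finite_induct)
     (auto simp: eval_fps_add fps_conv_radius_infinity_sum)

text \<open>Eventually \<open>c m\<close> is at most \<open>2 ^ m\<close> in norm, so the terms at
  \<open>z\<close> are dominated by those of \<open>F\<close> at \<open>2 * z\<close>. The
  multipliers in question are Gamma quotients.\<close>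

lemma fps_conv_radius_infinity_polynomial_growth:
  fixes F :: "complex fps"
  assumes F: "fps_conv_radius F = \<infinity>"
    and c: "\<And>m. norm (c m) \<le> C * (real m + 1) ^ k"
  shows "fps_conv_radius (Abs_fps (\<lambda>m. c m * fps_nth F m)) = \<infinity>"
  unfolding fps_conv_radius_def
proof (rule conv_radius_inftyI'')
  fix z :: complex
  have "eventually (\<lambda>m::nat. C * (real m + 1) ^ k \<le> 2 ^ m) at_top"
    by real_asymp
  hence "eventually (\<lambda>m. norm (c m * fps_nth F m * z ^ m) \<le> norm (fps_nth F m * (2 * z) ^ m)) at_top"
  proof eventually_elim
    case (elim m)
    have "norm (c m) \<le> 2 ^ m" using c[of m] elim by linarith
    hence "norm (c m) * norm (fps_nth F m * z ^ m) \<le> 2 ^ m * norm (fps_nth F m * z ^ m)"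
      by (intro mult_right_mono) auto
    thus ?case by (simp add: norm_mult norm_power power_mult_distrib mult_ac)
  qed
  thus "summable (\<lambda>m. fps_nth (Abs_fps (\<lambda>m. c m * fps_nth F m)) m * z ^ m)"
    using norm_summable_fps[of "2 * z" F] F
    by (auto intro: summable_comparison_test_ev)
qed

subsection \<open>The Caputo derivative of a power series in \<open>t powr \<alpha>\<close>\<close>

text \<open>
  Replaces \<open>powr\<close> where the exponent \<open>0\<close> has to give the constant \<open>1\<close> also at \<open>0\<close>.
\<close>

definition rpow :: "real \<Rightarrow> real \<Rightarrow> real" where
  "rpow \<beta> t = (if \<beta> = 0 then 1 else t powr \<beta>)"

text \<open>The difference quotient at 0 is \<open>g t\<close> itself, so continuity of
  \<open>g\<close> suffices. This settles the endpoint 0, where \<open>t powr \<alpha>\<close> may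
  fail to be differentiable.\<close>

lemma has_vector_derivative_scaleR_at_0:
  fixes g :: "real \<Rightarrow> 'a :: real_normed_vector"
  assumes "continuous (at 0 within S) g"
  shows "((\<lambda>t. t *\<^sub>R g t) has_vector_derivative g 0) (at 0 within S)"
proof -
  have "((\<lambda>t. g t - g 0) \<longlongrightarrow> 0) (at 0 within S)"
    using assms by (simp add: continuous_within LIM_zero)
  hence "((\<lambda>t. norm (g t - g 0)) \<longlongrightarrow> 0) (at 0 within S)"
    by (simp add: tendsto_norm_zero)
  moreover have "eventually (\<lambda>t. norm (g t - g 0) = norm ((1 / norm (t - 0)) *\<^sub>R (t *\<^sub>R g t - (0 *\<^sub>R g 0 + (t - 0) *\<^sub>R g 0)))) (at 0 within S)"
    unfolding eventually_at
    by (intro exI[of _ 1]) (auto simp: scaleR_right_diff_distrib [symmetric])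
  ultimately have "((\<lambda>t. norm ((1 / norm (t - 0)) *\<^sub>R (t *\<^sub>R g t - (0 *\<^sub>R g 0 + (t - 0) *\<^sub>R g 0)))) \<longlongrightarrow> 0) (at 0 within S)"
    by (rule Lim_transform_eventually)
  hence "((\<lambda>t. (1 / norm (t - 0)) *\<^sub>R (t *\<^sub>R g t - (0 *\<^sub>R g 0 + (t - 0) *\<^sub>R g 0))) \<longlongrightarrow> 0) (at 0 within S)"
    by (rule tendsto_norm_zero_cancel)
  thus ?thesis
    unfolding has_vector_derivative_def has_derivative_within
    by (simp add: bounded_linear_scaleR_left)
qed

lemma at_within_nonneg_neq_bot:
  fixes x :: real
  assumes "x \<ge> 0"
  shows "at x within {0..} \<noteq> bot"
proof -
  have "at_right x \<le> at x within {0..}" using assms by (intro at_le) auto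
  thus ?thesis using trivial_limit_at_right_real[of x] by (auto simp: bot_unique)
qed

text \<open>Termwise, t^(\<beta> + \<alpha> m) becomes (\<beta> + \<alpha> m) t^(\<beta> - 1 +
  \<alpha> m), so the shape is preserved and differentiation can be iterated. With \<beta> \<ge> 1
  the remaining power is nonnegative, and the formula also holds at 0.\<close>

lemma half_line_deriv_powser:
  fixes F :: "complex fps"
  assumes \<alpha>: "\<alpha> > 0" and \<beta>: "\<beta> \<ge> 1" and F: "fps_conv_radius F = \<infinity>"
    and \<phi>: "\<And>t. t \<ge> 0 \<Longrightarrow> \<phi> t = c + of_real (rpow \<beta> t) * eval_fps F (of_real (t powr \<alpha>))"
    and x: "x \<ge> 0"
  shows "half_line_deriv \<phi> x = of_real (rpow (\<beta> - 1) x) *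
     eval_fps (Abs_fps (\<lambda>m. of_real (\<beta> + \<alpha> * real m) * fps_nth F m)) (of_real (x powr \<alpha>))"
    (is "_ = ?D")
proof -
  define G where "G = Abs_fps (\<lambda>m. of_real (\<beta> + \<alpha> * real m) * fps_nth F m)"
  \<comment> \<open>Scaling the m-th coefficient by \<beta> + \<alpha> m is the Euler operator
    \<beta> + \<alpha> X d/dX; its two summands match those of the product rule.\<close>
  have G_eq: "G = fps_const (of_real \<beta>) * F + fps_const (of_real \<alpha>) * (fps_X * fps_deriv F)"
    by (rule fps_ext) (auto simp: G_def algebra_simps of_nat_diff)
  have eG: "eval_fps G z = of_real \<beta> * eval_fps F z + of_real \<alpha> * (z * eval_fps (fps_deriv F) z)" for z
    unfolding G_eq
    by (simp add: eval_fps_add eval_fps_mult F fps_conv_radius_infinity_mult fps_conv_radius_infinity_deriv)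
  \<comment> \<open>\<open>\<phi>\<close> is prescribed only for t \<ge> 0; this explicit function
    agrees with it there, which is all that the derivative within \<open>{0..}\<close> sees.\<close>
  define \<phi>' where "\<phi>' = (\<lambda>t. c + of_real (rpow \<beta> t) * eval_fps F (of_real (t powr \<alpha>)))"
  have "(\<phi>' has_vector_derivative ?D) (at x within {0..})"
  proof (cases "x = 0")
    case False
    with x have x: "x > 0" by simp
    have 1: "((\<lambda>t. t powr \<alpha>) has_vector_derivative (\<alpha> * x powr (\<alpha> - 1))) (at x within {0..})"
      using has_real_derivative_powr[OF x, of "\<alpha>"]
      by (simp add: has_real_derivative_iff_has_vector_derivative[symmetric] has_field_derivative_at_within)
    have 2: "((\<lambda>t. t powr \<beta>) has_vector_derivative (\<beta> * x powr (\<beta> - 1))) (at x within {0..})"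
      using has_real_derivative_powr[OF x, of "\<beta>"]
      by (simp add: has_real_derivative_iff_has_vector_derivative[symmetric] has_field_derivative_at_within)
    have 3: "((\<lambda>t. eval_fps F (of_real (t powr \<alpha>))) has_vector_derivative
           (\<alpha> * x powr (\<alpha> - 1)) *\<^sub>R eval_fps (fps_deriv F) (of_real (x powr \<alpha>))) (at x within {0..})"
    proof -
      have "((\<lambda>s. eval_fps F (of_real s)) has_vector_derivative eval_fps (fps_deriv F) (of_real (x powr \<alpha>)))
              (at (x powr \<alpha>) within (\<lambda>t. t powr \<alpha>) ` {0..})"
        by (intro has_vector_derivative_real_field has_field_derivative_eval_fps) (simp add: F)
      from vector_diff_chain_within[OF 1 this] show ?thesis by (simp add: o_def)
    qed
    have 4: "((\<lambda>t. c + (t powr \<beta>) *\<^sub>R eval_fps F (of_real (t powr \<alpha>))) has_vector_derivative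
          0 + ((x powr \<beta>) *\<^sub>R ((\<alpha> * x powr (\<alpha> - 1)) *\<^sub>R eval_fps (fps_deriv F) (of_real (x powr \<alpha>)))
            + (\<beta> * x powr (\<beta> - 1)) *\<^sub>R eval_fps F (of_real (x powr \<alpha>)))) (at x within {0..})"
      using 2 3 by (intro has_vector_derivative_add has_vector_derivative_const has_vector_derivative_scaleR)
        (auto simp: has_real_derivative_iff_has_vector_derivative)
    have "x powr \<beta> * x powr (\<alpha> - 1) = x powr (\<beta> - 1) * x powr \<alpha>"
      by (simp add: powr_add[symmetric] algebra_simps)
    hence eq: "complex_of_real (x powr \<beta>) * of_real (x powr (\<alpha> - 1))
              = of_real (x powr (\<beta> - 1)) * of_real (x powr \<alpha>)"
      by (simp only: of_real_mult[symmetric])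
    have "0 + ((x powr \<beta>) *\<^sub>R ((\<alpha> * x powr (\<alpha> - 1)) *\<^sub>R eval_fps (fps_deriv F) (of_real (x powr \<alpha>)))
            + (\<beta> * x powr (\<beta> - 1)) *\<^sub>R eval_fps F (of_real (x powr \<alpha>))) = ?D"
      unfolding G_def[symmetric] eG using x eq
      by (cases "\<beta> = 1") (simp_all add: scaleR_conv_of_real rpow_def algebra_simps)
    with 4 show ?thesis
      using \<beta> by (simp add: \<phi>'_def rpow_def scaleR_conv_of_real)
  next
    case True
    \<comment> \<open>At 0 the chain rule is replaced by splitting off a factor t: the function is
      \<open>c + t *\<^sub>R g t\<close> with continuous \<open>g\<close>, and its derivative is
      \<open>g 0\<close>.\<close>
    define g where "g = (\<lambda>t. of_real (rpow (\<beta> - 1) t) * eval_fps F (of_real (t powr \<alpha>)))"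
    have "continuous_on {0..} (\<lambda>t. t powr \<alpha>)"
      using \<alpha> by (intro continuous_on_powr') auto
    moreover have "continuous_on {0..} (rpow (\<beta> - 1))"
    proof (cases "\<beta> = 1")
      case False
      thus ?thesis using \<beta> unfolding rpow_def by (auto intro!: continuous_on_powr')
    qed (simp add: rpow_def)
    moreover have "continuous_on UNIV (eval_fps F)"
      by (auto simp: continuous_on_eq_continuous_within F intro!: continuous_eval_fps)
    ultimately have "continuous_on {0..} g"
      unfolding g_def by (auto simp: F intro!: continuous_intros intro: continuous_on_compose2)
    hence "continuous (at 0 within {0..}) g" by (simp add: continuous_on_eq_continuous_within)
    from has_vector_derivative_scaleR_at_0[OF this]
    have "((\<lambda>t. c + t *\<^sub>R g t) has_vector_derivative 0 + g 0) (at 0 within {0..})"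
      by (intro has_vector_derivative_add has_vector_derivative_const)
    moreover have "c + t *\<^sub>R g t = \<phi>' t" if "t \<ge> 0" for t
    proof (cases "\<beta> = 1")
      case False
      with \<beta> have "\<beta> \<noteq> 0" "\<beta> - 1 \<noteq> 0" by auto
      hence "t * rpow (\<beta> - 1) t = rpow \<beta> t"
        using that by (simp add: rpow_def powr_mult_base)
      thus ?thesis by (simp add: g_def \<phi>'_def scaleR_conv_of_real flip: of_real_mult)
    qed (use that in \<open>simp add: g_def \<phi>'_def rpow_def scaleR_conv_of_real\<close>)
    moreover have "g 0 = ?D" using True \<beta> \<alpha>
      by (auto simp: g_def rpow_def eval_fps_at_0)
    ultimately show ?thesis
      using True by (auto intro: has_vector_derivative_transform[rotated -1])
  qed
  hence "(\<phi> has_vector_derivative ?D) (at x within {0..})"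
    using x \<phi> by (auto simp: \<phi>'_def intro: has_vector_derivative_transform[rotated -1])
  moreover have "at x within {0..} \<noteq> bot"
    using x by (rule at_within_nonneg_neq_bot)
  ultimately show ?thesis
    unfolding half_line_deriv_def by (intro vector_derivative_within)
qed

text \<open>The multipliers of successive derivatives accumulate to a falling product. The bound
  \<open>\<beta> \<ge> real k\<close> keeps every exponent that gets differentiated at least 1; the
  constant disappears with the first derivative.\<close>

lemma half_line_deriv_funpow_powser:
  fixes F :: "complex fps"
  assumes \<alpha>: "\<alpha> > 0" and F: "fps_conv_radius F = \<infinity>"
    and \<phi>: "\<And>t. t \<ge> 0 \<Longrightarrow> \<phi> t = c + of_real (rpow \<beta> t) * eval_fps F (of_real (t powr \<alpha>))"
    and "\<beta> \<ge> real k" "x \<ge> 0"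
  shows "(half_line_deriv ^^ k) \<phi> x = (if k = 0 then c else 0) + of_real (rpow (\<beta> - real k) x) *
     eval_fps (Abs_fps (\<lambda>m. of_real (\<Prod>i<k. \<beta> - real i + \<alpha> * real m) * fps_nth F m)) (of_real (x powr \<alpha>))"
    (is "_ = _ + _ * eval_fps (?G k) _")
  using assms(4,5)
proof (induction k arbitrary: x)
  case 0
  thus ?case using \<phi> by (simp add: fps_nth_inverse)
next
  case (Suc k)
  have G: "fps_conv_radius (?G k) = \<infinity>" for k
  proof (induction k)
    case (Suc k)
    have "?G (Suc k) = fps_const (of_real (\<beta> - real k)) * ?G k + fps_const (of_real \<alpha>) * (fps_X * fps_deriv (?G k))"
      by (rule fps_ext) (auto simp: algebra_simps of_nat_diff)
    thus ?case using Suc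
      by (simp add: fps_conv_radius_infinity_add fps_conv_radius_infinity_mult fps_conv_radius_infinity_deriv)
  qed (use F in \<open>simp add: fps_nth_inverse\<close>)
  have "half_line_deriv ((half_line_deriv ^^ k) \<phi>) x = of_real (rpow (\<beta> - real k - 1) x) *
     eval_fps (Abs_fps (\<lambda>m. of_real (\<beta> - real k + \<alpha> * real m) * fps_nth (?G k) m)) (of_real (x powr \<alpha>))"
    using Suc.prems by (intro half_line_deriv_powser[OF \<alpha> _ G Suc.IH]) auto
  thus ?case by (simp add: algebra_simps)
qed

text \<open>Scaling by x carries the Beta integral over [0, 1] to this one; homogeneity of the
  integrand accounts for the power of x.\<close>

lemma has_integral_Beta_interval:
  fixes x a \<gamma> :: real
  assumes "x > 0" "a > -1" "\<gamma> > 0"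
  shows "((\<lambda>t. (x - t) powr (\<gamma> - 1) * t powr a) has_integral x powr (a + \<gamma>) * Beta (a + 1) \<gamma>) {0..x}"
proof -
  let ?f = "\<lambda>t. t powr (a + 1 - 1) * (1 - t) powr (\<gamma> - 1)"
  have "(?f has_integral Beta (a + 1) \<gamma>) (cbox 0 1)"
    using has_integral_Beta_real[of "a + 1" \<gamma>] assms by simp
  from has_integral_affinity'[OF this, of "1 / x" 0]
  have "((\<lambda>t. ?f (t / x)) has_integral x * Beta (a + 1) \<gamma>) {0..x}"
    using assms by (simp add: field_simps)
  from has_integral_mult_right[OF this, of "x powr (a + \<gamma> - 1)"]
  have "((\<lambda>t. x powr (a + \<gamma> - 1) * ?f (t / x)) has_integral x powr (a + \<gamma> - 1) * (x * Beta (a + 1) \<gamma>)) {0..x}" .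
  also have "x powr (a + \<gamma> - 1) * (x * Beta (a + 1) \<gamma>) = x powr (a + \<gamma>) * Beta (a + 1) \<gamma>"
    using assms by (simp add: powr_diff)
  finally show ?thesis
  proof (rule has_integral_eq[rotated])
    fix t assume t: "t \<in> {0..x}"
    have "x powr (a + \<gamma> - 1) * ?f (t / x) = x powr (a + \<gamma> - 1) * ((t / x) powr a * ((x - t) / x) powr (\<gamma> - 1))"
      using assms by (simp add: field_simps)
    also have "\<dots> = (x powr (a + \<gamma> - 1) / (x powr a * x powr (\<gamma> - 1))) * ((x - t) powr (\<gamma> - 1) * t powr a)"
      using t assms by (simp add: powr_divide)
    also have "x powr (a + \<gamma> - 1) / (x powr a * x powr (\<gamma> - 1)) = 1"
      using assms by (simp add: powr_add[symmetric] algebra_simps)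
    finally show "x powr (a + \<gamma> - 1) * ?f (t / x) = (x - t) powr (\<gamma> - 1) * t powr a" by simp
  qed
qed

text \<open>The extra factor \<open>t powr \<alpha>\<close> makes both sides 0 at t = 0, so that the
  endpoint and m = 0 cause no exception.\<close>

lemma powr_powr_nat:
  fixes t :: real
  assumes "t \<ge> 0"
  shows "t powr \<alpha> * (t powr \<alpha>) ^ m = t powr (\<alpha> * (real m + 1))"
proof (cases "t = 0")
  case False
  thus ?thesis using assms by (simp add: powr_power powr_add[symmetric] algebra_simps)
qed auto

text \<open>The Beta integral turns each term into a power with factor Beta / Gamma \<gamma>, which
  is the stated Gamma quotient; absolute summability of the integrals permits exchanging sum and
  integral.\<close>

lemma frac_integral_powser:
  fixes F :: "complex fps"
  assumes \<alpha>: "\<alpha> > 0" and \<gamma>: "\<gamma> \<ge> 0" and F: "fps_conv_radius F = \<infinity>"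
    and \<psi>: "\<And>t. t \<ge> 0 \<Longrightarrow> \<psi> t = of_real (t powr \<alpha>) * eval_fps F (of_real (t powr \<alpha>))"
    and x: "x \<ge> 0"
  shows "frac_integral \<gamma> \<psi> x = of_real (x powr (\<alpha> + \<gamma>)) *
      eval_fps (Abs_fps (\<lambda>m. of_real (Gamma (\<alpha> * (real m + 1) + 1) / Gamma (\<alpha> * (real m + 1) + \<gamma> + 1)) * fps_nth F m))
        (of_real (x powr \<alpha>))"
proof -
  consider "\<gamma> = 0" | "\<gamma> > 0" "x = 0" | "\<gamma> > 0" "x > 0" using x \<gamma> by linarith
  thus ?thesis
  proof cases
    case 1
    have "Gamma (\<alpha> * (real m + 1) + 1) > 0" for m
      using \<alpha> by (intro Gamma_real_pos) (auto intro: add_nonneg_pos)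
    hence "Gamma (\<alpha> * (real m + 1) + 1) \<noteq> 0" for m
      by (metis less_irrefl)
    thus ?thesis using 1 \<psi>[OF x] by (simp add: frac_integral_def fps_nth_inverse)
  next
    case 2
    \<comment> \<open>At the single point of the interval the kernel is
      \<open>0 powr (\<gamma> - 1)\<close>, which is 0 by convention.\<close>
    have "(LINT t:{0}|lebesgue. ((- t) powr (\<gamma> - 1)) *\<^sub>R \<psi> t) = (LINT t:{0::real}|lebesgue. 0)"
      unfolding set_lebesgue_integral_def
      by (intro Bochner_Integration.integral_cong) (auto simp: indicator_def)
    with 2 show ?thesis by (simp add: frac_integral_def)
  next
    case 3
    define g where "g = (\<lambda>m t. (x - t) powr (\<gamma> - 1) * t powr (\<alpha> * (real m + 1)))"
    define I where "I = (\<lambda>m. x powr (\<alpha> * (real m + 1) + \<gamma>) * Beta (\<alpha> * (real m + 1) + 1) \<gamma>)"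
    have hi: "(g m has_integral I m) {0..x}" for m
      unfolding g_def I_def using 3 \<alpha>
      by (intro has_integral_Beta_interval) (auto intro: less_le_trans[of "-1" 0])
    have g_int: "set_integrable lebesgue {0..x} (g m)" for m
      using hi[of m] by (intro nonnegative_absolutely_integrable_1) (auto simp: g_def)
    have g_eq: "(LINT t:{0..x}|lebesgue. g m t) = I m" for m
      using set_lebesgue_integral_eq_integral(2)[OF g_int] hi by (simp add: integral_unique)
    define f where "f = (\<lambda>m t. fps_nth F m * complex_of_real (indicator {0..x} t *\<^sub>R g m t))"
    have f_int: "integrable lebesgue (f m)" for m
      unfolding f_def using g_int[of m]
      by (intro integrable_mult_right integrable_of_real) (simp add: set_integrable_def)
    have f_eq: "integral\<^sup>L lebesgue (f m) = fps_nth F m * of_real (I m)" for m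
      unfolding f_def using g_eq[of m]
      by (simp add: set_lebesgue_integral_def del: real_scaleR_def of_real_mult)
    have f_norm: "integral\<^sup>L lebesgue (\<lambda>t. norm (f m t)) = norm (fps_nth F m) * I m" for m
    proof -
      have "(\<lambda>t. norm (f m t)) = (\<lambda>t. norm (fps_nth F m) * (indicator {0..x} t *\<^sub>R g m t))"
        by (auto simp: f_def g_def norm_mult abs_mult)
      thus ?thesis using g_eq[of m] by (simp add: set_lebesgue_integral_def)
    qed
    have f_sum: "(\<lambda>m. f m t) sums (indicator {0..x} t *\<^sub>R (((x - t) powr (\<gamma> - 1)) *\<^sub>R \<psi> t))" for t
    proof (cases "t \<in> {0..x}")
      case True
      hence t: "t \<ge> 0" by simp
      have "(\<lambda>m. fps_nth F m * of_real (t powr \<alpha>) ^ m) sums eval_fps F (of_real (t powr \<alpha>))"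
        by (rule sums_eval_fps) (simp add: F)
      from sums_mult[OF this, of "of_real ((x - t) powr (\<gamma> - 1) * t powr \<alpha>)"]
      have "(\<lambda>m. of_real ((x - t) powr (\<gamma> - 1) * t powr \<alpha>) * (fps_nth F m * of_real (t powr \<alpha>) ^ m))
              sums (of_real ((x - t) powr (\<gamma> - 1)) * \<psi> t)"
        using \<psi>[OF t] by (simp add: mult.assoc)
      also have "(\<lambda>m. of_real ((x - t) powr (\<gamma> - 1) * t powr \<alpha>) * (fps_nth F m * of_real (t powr \<alpha>) ^ m)) = (\<lambda>m. f m t)"
        using True by (auto simp: f_def g_def powr_powr_nat[OF t, symmetric] fun_eq_iff)
      finally show ?thesis using True by (simp add: scaleR_conv_of_real)
    qed (auto simp: f_def)
    have f_abs: "summable (\<lambda>m. norm (f m t))" for t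
    proof (cases "t \<in> {0..x}")
      case True
      hence t: "t \<ge> 0" by simp
      have "summable (\<lambda>m. norm (fps_nth F m * of_real (t powr \<alpha>) ^ m))"
        by (rule norm_summable_fps) (simp add: F)
      from summable_mult[OF this, of "(x - t) powr (\<gamma> - 1) * t powr \<alpha>"]
      show ?thesis using True
        by (simp add: f_def g_def powr_powr_nat[OF t, symmetric] norm_mult abs_mult norm_power mult_ac)
    qed (auto simp: f_def)
    \<comment> \<open>Beta decreases in its first argument, so \<open>Beta 1 \<gamma>\<close> bounds
      all the Beta factors and the absolutely convergent series of \<open>F\<close> at
      \<open>x powr \<alpha>\<close> dominates.\<close>
    have "summable (\<lambda>m. norm (fps_nth F m) * I m)"
    proof (rule summable_comparison_test')
      have "summable (\<lambda>m. norm (fps_nth F m * of_real (x powr \<alpha>) ^ m))"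
        by (rule norm_summable_fps) (simp add: F)
      from summable_mult2[OF this]
      show "summable (\<lambda>m. norm (fps_nth F m * of_real (x powr \<alpha>) ^ m) * (x powr (\<alpha> + \<gamma>) * Beta 1 \<gamma>))" .
      fix m :: nat
      have "I m \<le> x powr (\<alpha> * (real m + 1) + \<gamma>) * Beta 1 \<gamma>"
        unfolding I_def using 3 \<alpha> by (intro mult_left_mono Beta_real_mono) auto
      also have "x powr (\<alpha> * (real m + 1) + \<gamma>) = (x powr \<alpha>) ^ m * x powr (\<alpha> + \<gamma>)"
        using 3 by (simp add: powr_add powr_powr_nat[of x, symmetric])
      finally have le: "I m \<le> (x powr \<alpha>) ^ m * x powr (\<alpha> + \<gamma>) * Beta 1 \<gamma>" .
      have "I m \<ge> 0" using hi[of m] by (rule has_integral_nonneg) (auto simp: g_def)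
      with mult_left_mono[OF le, of "norm (fps_nth F m)"]
      show "norm (norm (fps_nth F m) * I m)
         \<le> norm (fps_nth F m * of_real (x powr \<alpha>) ^ m) * (x powr (\<alpha> + \<gamma>) * Beta 1 \<gamma>)"
        by (simp add: norm_mult norm_power mult_ac)
    qed
    hence "(\<lambda>m. integral\<^sup>L lebesgue (f m)) sums (LINT t|lebesgue. (\<Sum>m. f m t))"
      using f_int f_abs f_norm by (intro sums_integral) auto
    also have "(LINT t|lebesgue. (\<Sum>m. f m t)) = (LINT t:{0..x}|lebesgue. ((x - t) powr (\<gamma> - 1)) *\<^sub>R \<psi> t)"
      unfolding set_lebesgue_integral_def using f_sum by (intro Bochner_Integration.integral_cong refl) (auto simp: sums_iff)
    finally have S: "(\<lambda>m. fps_nth F m * of_real (I m)) sums (LINT t:{0..x}|lebesgue. ((x - t) powr (\<gamma> - 1)) *\<^sub>R \<psi> t)"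
      unfolding f_eq .
    \<comment> \<open>\<open>c\<close> collects the factors of \<open>I m\<close> that are
      independent of m; its Gamma factor cancels the one in the definition of the fractional
      integral.\<close>
    define c where "c = complex_of_real (x powr (\<alpha> + \<gamma>) * Gamma \<gamma>)"
    let ?r = "\<lambda>m. Gamma (\<alpha> * (real m + 1) + 1) / Gamma (\<alpha> * (real m + 1) + \<gamma> + 1)"
    have "Gamma \<gamma> > 0" using 3 by simp
    hence "Gamma \<gamma> \<noteq> 0" by (metis less_irrefl)
    hence c: "c \<noteq> 0" using 3 by (simp add: c_def)
    have "I m = x powr (\<alpha> + \<gamma>) * Gamma \<gamma> * (?r m * (x powr \<alpha>) ^ m)" for m
    proof -
      have "x powr (\<alpha> * (real m + 1) + \<gamma>) = (x powr \<alpha>) ^ m * x powr (\<alpha> + \<gamma>)"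
        using 3 by (simp add: powr_add powr_powr_nat[of x, symmetric])
      thus ?thesis by (simp add: I_def Beta_def algebra_simps)
    qed
    hence "fps_nth F m * of_real (I m) = c * ((of_real (?r m) * fps_nth F m) * of_real (x powr \<alpha>) ^ m)" for m
      by (simp only: c_def of_real_mult of_real_power mult_ac)
    with S have "(\<lambda>m. c * ((of_real (?r m) * fps_nth F m) * of_real (x powr \<alpha>) ^ m)) sums
         (LINT t:{0..x}|lebesgue. ((x - t) powr (\<gamma> - 1)) *\<^sub>R \<psi> t)" by simp
    from sums_mult[OF this, of "1 / c"]
    have "(\<lambda>m. (of_real (?r m) * fps_nth F m) * of_real (x powr \<alpha>) ^ m) sums
         ((1 / c) * (LINT t:{0..x}|lebesgue. ((x - t) powr (\<gamma> - 1)) *\<^sub>R \<psi> t))"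
      using c by simp
    hence "eval_fps (Abs_fps (\<lambda>m. of_real (?r m) * fps_nth F m)) (of_real (x powr \<alpha>))
         = (1 / c) * (LINT t:{0..x}|lebesgue. ((x - t) powr (\<gamma> - 1)) *\<^sub>R \<psi> t)"
      by (simp add: eval_fps_def sums_iff)
    thus ?thesis using 3 \<open>Gamma \<gamma> \<noteq> 0\<close>
      by (simp add: frac_integral_def scaleR_conv_of_real c_def field_simps)
  qed
qed

text \<open>Once the constant term is removed, the fractional integral raises the exponents \<alpha>
  (m + 1) to l + \<alpha> m, and l ordinary derivatives lower them to \<alpha> m. The factors from
  both operations combine to one Gamma quotient.\<close>

lemma caputo_deriv_powser:
  fixes F :: "complex fps"
  assumes \<alpha>: "\<alpha> > 0" and F: "fps_conv_radius F = \<infinity>"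
    and y: "\<And>t. t \<ge> 0 \<Longrightarrow> y t = eval_fps F (of_real (t powr \<alpha>))"
    and x: "x \<ge> 0"
  shows "caputo_deriv \<alpha> y x =
    eval_fps (Abs_fps (\<lambda>m. of_real (Gamma (\<alpha> * (real m + 1) + 1) / Gamma (\<alpha> * real m + 1)) * fps_nth F (Suc m)))
      (of_real (x powr \<alpha>))"
proof -
  define l where "l = nat \<lceil>\<alpha>\<rceil>"
  have l: "l \<ge> 1" "real l - 1 < \<alpha>" "\<alpha> \<le> real l"
    using \<alpha> by (auto simp: l_def) linarith+
  define S where "S = fps_shift 1 F"
  have S: "fps_conv_radius S = \<infinity>" by (simp add: S_def F)
  have "F = fps_const (fps_nth F 0) + fps_X * S"
    by (rule fps_ext) (auto simp: S_def)
  hence eF: "eval_fps F z = fps_nth F 0 + z * eval_fps S z" for z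
    by (metis F S UNIV_I eval_fps_X eval_fps_add eval_fps_const eval_fps_mult ereal_less(5)
         fps_conv_radius_const fps_conv_radius_fps_X fps_conv_radius_infinity_mult ereal_infty_less(1)
         PInfty_neq_ereal(1))
  have y': "y t = fps_nth F 0 + of_real (rpow \<alpha> t) * eval_fps S (of_real (t powr \<alpha>))" if "t \<ge> 0" for t
    using y[OF that] eF \<alpha> by (simp add: rpow_def)
  \<comment> \<open>For k < l also k < \<alpha>, so the nonconstant part leaves a positive power of
    t that vanishes at 0. The Taylor polynomial is therefore just the constant term.\<close>
  have d0: "(half_line_deriv ^^ k) y 0 = (if k = 0 then fps_nth F 0 else 0)" if "k < l" for k
  proof -
    have "real k \<le> real l - 1" using that l by linarith
    hence k: "real k < \<alpha>" using l by linarith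
    from half_line_deriv_funpow_powser[OF \<alpha> S y' less_imp_le[OF k] order_refl]
    show ?thesis using k by (simp add: rpow_def)
  qed
  have T: "(\<Sum>k<l. (half_line_deriv ^^ k) y 0 / fact k * of_real t ^ k) = fps_nth F 0" for t
  proof -
    have "(\<Sum>k<l. (half_line_deriv ^^ k) y 0 / fact k * of_real t ^ k)
        = (\<Sum>k<l. if k = 0 then fps_nth F 0 else 0)"
      by (intro sum.cong) (auto simp: d0)
    also have "\<dots> = fps_nth F 0" using l by (subst sum.delta) auto
    finally show ?thesis .
  qed
  define \<psi> where "\<psi> = (\<lambda>t. y t - fps_nth F 0)"
  define r where "r = (\<lambda>m. Gamma (\<alpha> * (real m + 1) + 1) / Gamma (\<alpha> * (real m + 1) + (real l - \<alpha>) + 1))"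
  define H where "H = Abs_fps (\<lambda>m. of_real (r m) * fps_nth S m)"
  \<comment> \<open>The lower Gamma bound, with base at least \<alpha>, makes these multipliers
    bounded; this is polynomial growth of degree 0.\<close>
  have r: "norm (complex_of_real (r m)) \<le> (1 / \<alpha> powr (real l - \<alpha>)) * (real m + 1) ^ 0" for m
  proof -
    have a: "\<alpha> * (real m + 1) > 0" using \<alpha> by simp
    have "\<alpha> powr (real l - \<alpha>) \<le> (\<alpha> * (real m + 1) + 1 - 1) powr (real l - \<alpha>)"
      using \<alpha> l by (intro powr_mono2) auto
    also have "\<dots> \<le> Gamma (\<alpha> * (real m + 1) + 1 + (real l - \<alpha>)) / Gamma (\<alpha> * (real m + 1) + 1)"
      using a l by (intro Gamma_ratio_lower) auto
    also have "\<dots> = 1 / r m" by (simp add: r_def add_ac)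
    finally have 1: "\<alpha> powr (real l - \<alpha>) \<le> 1 / r m" .
    have "r m > 0" unfolding r_def using a l by (intro divide_pos_pos Gamma_real_pos; linarith)
    with 1 show ?thesis using \<alpha> by (simp add: field_simps)
  qed
  have H: "fps_conv_radius H = \<infinity>"
    unfolding H_def using r
    by (rule fps_conv_radius_infinity_polynomial_growth[OF S])
  have fi: "frac_integral (real l - \<alpha>) \<psi> t = 0 + of_real (rpow (real l) t) * eval_fps H (of_real (t powr \<alpha>))"
    if "t \<ge> 0" for t
    using frac_integral_powser[OF \<alpha> _ S _ that, of "real l - \<alpha>" \<psi>] l eF y
    by (simp add: \<psi>_def rpow_def H_def r_def)
  \<comment> \<open>Read backwards, the product is a Pochhammer symbol, and its Gamma value at the
    top cancels the denominator of \<open>r m\<close>.\<close>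
  have pr: "(\<Prod>i<l. real l - real i + \<alpha> * real m) * r m = Gamma (\<alpha> * (real m + 1) + 1) / Gamma (\<alpha> * real m + 1)" for m
  proof -
    have a: "\<alpha> * real m + 1 > 0" using \<alpha> by (intro add_nonneg_pos) auto
    have "(\<Prod>i<l. real l - real i + \<alpha> * real m) = (\<Prod>i<l. \<alpha> * real m + 1 + real (l - Suc i))"
      by (intro prod.cong) (auto simp: of_nat_diff)
    also have "\<dots> = pochhammer (\<alpha> * real m + 1) l"
      unfolding pochhammer_prod lessThan_atLeast0[symmetric] by (rule prod.nat_diff_reindex)
    also have "\<dots> = Gamma (\<alpha> * real m + 1 + real l) / Gamma (\<alpha> * real m + 1)"
      using a by (intro pochhammer_Gamma) (auto elim!: nonpos_Ints_cases)
    finally have 1: "(\<Prod>i<l. real l - real i + \<alpha> * real m) = \<dots>" .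
    have 2: "\<alpha> * (real m + 1) + (real l - \<alpha>) + 1 = \<alpha> * real m + 1 + real l"
      by (simp add: algebra_simps)
    have "Gamma (\<alpha> * real m + 1 + real l) > 0" using a by (intro Gamma_real_pos) auto
    hence "Gamma (\<alpha> * real m + 1 + real l) \<noteq> 0" by (metis less_irrefl)
    thus ?thesis unfolding r_def 1 2 by simp
  qed
  have "caputo_deriv \<alpha> y x = (half_line_deriv ^^ l) (frac_integral (real l - \<alpha>) \<psi>) x"
    unfolding caputo_deriv_def riemann_liouville_deriv_def Let_def l_def[symmetric] T \<psi>_def ..
  also have "\<dots> = eval_fps (Abs_fps (\<lambda>m. of_real (\<Prod>i<l. real l - real i + \<alpha> * real m) * fps_nth H m)) (of_real (x powr \<alpha>))"
    using half_line_deriv_funpow_powser[OF \<alpha> H fi order_refl x] l by (simp add: rpow_def)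
  also have "Abs_fps (\<lambda>m. of_real (\<Prod>i<l. real l - real i + \<alpha> * real m) * fps_nth H m) =
      Abs_fps (\<lambda>m. of_real (Gamma (\<alpha> * (real m + 1) + 1) / Gamma (\<alpha> * real m + 1)) * fps_nth F (Suc m))"
    unfolding pr[symmetric] H_def S_def by (simp add: mult_ac)
  finally show ?thesis .
qed

text \<open>The Gamma quotients of successive steps telescope. Convergence is carried through the
  same induction because each further derivative needs an entire series.\<close>

lemma caputo_deriv_funpow_powser:
  fixes F :: "complex fps"
  assumes \<alpha>: "\<alpha> > 0" and F: "fps_conv_radius F = \<infinity>"
    and y: "\<And>t. t \<ge> 0 \<Longrightarrow> y t = eval_fps F (of_real (t powr \<alpha>))"
  defines "D \<equiv> \<lambda>j. Abs_fps (\<lambda>m. of_real (Gamma (\<alpha> * real (m + j) + 1) / Gamma (\<alpha> * real m + 1)) * fps_nth F (m + j))"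
  shows "fps_conv_radius (D j) = \<infinity> \<and>
     (\<forall>t\<ge>0. (caputo_deriv \<alpha> ^^ j) y t = eval_fps (D j) (of_real (t powr \<alpha>)))"
proof (induction j)
  case 0
  have "Gamma (\<alpha> * real m + 1) > 0" for m
    using \<alpha> by (intro Gamma_real_pos add_nonneg_pos) auto
  hence "Gamma (\<alpha> * real m + 1) \<noteq> 0" for m
    by (metis less_irrefl)
  thus ?case using F y by (simp add: D_def fps_nth_inverse)
next
  case (Suc j)
  define c where "c = (\<lambda>m. Gamma (\<alpha> * (real m + 1) + 1) / Gamma (\<alpha> * real m + 1))"
  have pos: "Gamma (\<alpha> * real m + 1) > 0" for m
    using \<alpha> by (intro Gamma_real_pos add_nonneg_pos) auto
  have eq: "D (Suc j) = Abs_fps (\<lambda>m. of_real (c m) * fps_nth (D j) (Suc m))"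
  proof (rule fps_ext)
    fix m
    have "Gamma (\<alpha> * (real m + 1) + 1) \<noteq> 0" using pos[of "Suc m"] by (simp add: add_ac)
    thus "fps_nth (D (Suc j)) m = fps_nth (Abs_fps (\<lambda>m. of_real (c m) * fps_nth (D j) (Suc m))) m"
      by (simp add: D_def c_def add_ac)
  qed
  \<comment> \<open>The exponent \<alpha> is rounded up to a natural number, which is legitimate
    since the base is at least 1.\<close>
  have c_le: "norm (complex_of_real (c m)) \<le> (\<alpha> + 1) ^ nat \<lceil>\<alpha>\<rceil> * (real m + 1) ^ nat \<lceil>\<alpha>\<rceil>" for m
  proof -
    have "c m = Gamma (\<alpha> * real m + 1 + \<alpha>) / Gamma (\<alpha> * real m + 1)"
      by (simp add: c_def algebra_simps)
    also have "\<dots> \<le> (\<alpha> * real m + 1 + \<alpha>) powr \<alpha>"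
      using \<alpha> by (intro Gamma_ratio_upper add_nonneg_pos) auto
    also have "\<dots> \<le> ((\<alpha> + 1) * (real m + 1)) powr \<alpha>"
      using \<alpha> by (intro powr_mono2) (auto simp: algebra_simps)
    also have "\<dots> \<le> ((\<alpha> + 1) * (real m + 1)) powr (real (nat \<lceil>\<alpha>\<rceil>))"
    proof (rule powr_mono)
      have "1 * 1 \<le> (\<alpha> + 1) * (real m + 1)" using \<alpha> by (intro mult_mono) auto
      thus "1 \<le> (\<alpha> + 1) * (real m + 1)" by simp
    qed linarith
    also have "\<dots> = (\<alpha> + 1) ^ nat \<lceil>\<alpha>\<rceil> * (real m + 1) ^ nat \<lceil>\<alpha>\<rceil>"
      using \<alpha> by (subst powr_realpow) (auto simp: power_mult_distrib)
    finally have "c m \<le> \<dots>" .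
    moreover have "c m > 0" using pos[of m] pos[of "Suc m"] by (simp add: c_def add_ac)
    ultimately show ?thesis by simp
  qed
  have "fps_conv_radius (Abs_fps (\<lambda>m. of_real (c m) * fps_nth (fps_shift 1 (D j)) m)) = \<infinity>"
    using Suc.IH by (intro fps_conv_radius_infinity_polynomial_growth[OF _ c_le]) simp
  moreover have "(caputo_deriv \<alpha> ^^ Suc j) y t = eval_fps (D (Suc j)) (of_real (t powr \<alpha>))"
    if "t \<ge> 0" for t
    using caputo_deriv_powser[OF \<alpha>, of "D j" "(caputo_deriv \<alpha> ^^ j) y" t] Suc.IH that
    by (simp add: eq c_def)
  ultimately show ?case by (simp add: eq)
qed

section \<open>The recurrence for the coefficients of a solution\<close>

text \<open>The identity theorem applies because 0 is a limit point of the nonnegative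
  reals.\<close>

lemma eval_fps_eq_0_on_reals:
  fixes G :: "complex fps"
  assumes G: "fps_conv_radius G = \<infinity>" and 0: "\<And>s. s \<ge> 0 \<Longrightarrow> eval_fps G (of_real s) = 0"
  shows "G = 0"
proof -
  have "eval_fps G w = 0" for w
  proof (rule analytic_continuation[where f = "eval_fps G" and S = UNIV and U = "of_real ` {0..}" and \<xi> = 0])
    show "eval_fps G holomorphic_on UNIV"
      by (intro holomorphic_on_eval_fps) (auto simp: G)
    have "(0::real) islimpt {0..}"
      using at_within_nonneg_neq_bot[of 0] by (simp add: trivial_limit_within)
    hence "of_real 0 islimpt (of_real ` {0..} :: complex set)"
      by (rule islimpt_isCont_image) (auto simp: eventually_at intro!: exI[of _ 1])
    thus "0 islimpt (of_real ` {0..} :: complex set)" by simp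
    show "eval_fps G z = 0" if "z \<in> of_real ` {0..}" for z using that 0 by auto
  qed (simp_all add: convex_connected)
  hence "eval_fps G = eval_fps 0" by auto
  hence "fps_nth G m = fps_nth 0 m" for m
    using fps_nth_fps_expansion[OF eval_fps_has_fps_expansion, of G m]
          fps_nth_fps_expansion[OF eval_fps_has_fps_expansion, of "0 :: complex fps" m] G
    by simp
  thus ?thesis by (simp add: fps_eq_iff)
qed

text \<open>As t runs through the half-line, so does t^\<alpha>. The equation thus makes an entire
  series vanish on the nonnegative reals, and its coefficients are these Cauchy products.\<close>

lemma coefficient_recurrence:
  fixes F :: "complex fps" and Q :: "nat \<Rightarrow> complex poly"
  assumes \<alpha>: "\<alpha> > 0" and F: "fps_conv_radius F = \<infinity>"
    and y: "\<And>t. t \<ge> 0 \<Longrightarrow> y t = eval_fps F (of_real (t powr \<alpha>))"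
    and eq: "\<And>t. t \<ge> 0 \<Longrightarrow> (\<Sum>j\<le>n. poly (Q j) (of_real (t powr \<alpha>)) * (caputo_deriv \<alpha> ^^ j) y t) = 0"
  shows "(\<Sum>j\<le>n. \<Sum>i\<le>m. coeff (Q j) i * (of_real (Gamma (\<alpha> * real (m - i + j) + 1) / Gamma (\<alpha> * real (m - i) + 1)) *
            fps_nth F (m - i + j))) = 0"
proof -
  define D where "D = (\<lambda>j. Abs_fps (\<lambda>m. of_real (Gamma (\<alpha> * real (m + j) + 1) / Gamma (\<alpha> * real m + 1)) * fps_nth F (m + j)))"
  have D: "fps_conv_radius (D j) = \<infinity>"
    "\<And>t. t \<ge> 0 \<Longrightarrow> (caputo_deriv \<alpha> ^^ j) y t = eval_fps (D j) (of_real (t powr \<alpha>))" for j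
    using caputo_deriv_funpow_powser[OF \<alpha> F y] unfolding D_def by blast+
  define G where "G = (\<Sum>j\<le>n. fps_of_poly (Q j) * D j)"
  have "G = 0"
  proof (rule eval_fps_eq_0_on_reals)
    show "fps_conv_radius G = \<infinity>"
      unfolding G_def using D by (intro fps_conv_radius_infinity_sum fps_conv_radius_infinity_mult) auto
    fix s :: real assume s: "s \<ge> 0"
    define t where "t = s powr (1 / \<alpha>)"
    have t: "t \<ge> 0" "t powr \<alpha> = s" using s \<alpha> by (auto simp: t_def powr_powr)
    have "eval_fps G (of_real s) = (\<Sum>j\<le>n. eval_fps (fps_of_poly (Q j) * D j) (of_real s))"
      unfolding G_def using D by (intro eval_fps_sum_entire fps_conv_radius_infinity_mult) auto
    also have "\<dots> = (\<Sum>j\<le>n. poly (Q j) (of_real (t powr \<alpha>)) * (caputo_deriv \<alpha> ^^ j) y t)"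
      using t D by (intro sum.cong) (auto simp: eval_fps_mult)
    also have "\<dots> = 0" using eq[OF t(1)] by simp
    finally show "eval_fps G (of_real s) = 0" .
  qed
  have "(\<Sum>j\<le>n. \<Sum>i\<le>m. coeff (Q j) i * (of_real (Gamma (\<alpha> * real (m - i + j) + 1) / Gamma (\<alpha> * real (m - i) + 1)) *
            fps_nth F (m - i + j))) = fps_nth G m"
    by (simp only: G_def fps_sum_nth fps_mult_nth D_def atLeast0AtMost fps_of_poly_nth fps_nth_Abs_fps)
  with \<open>G = 0\<close> show ?thesis by simp
qed

subsection \<open>Order and coefficients of an entire function\<close>

lemma power_le_fact_exp:
  fixes x :: real
  assumes "x \<ge> 0"
  shows "x ^ m \<le> fact m * exp x"
proof -
  have "(\<Sum>k\<in>{m}. x ^ k /\<^sub>R fact k) \<le> (\<Sum>k. x ^ k /\<^sub>R fact k)"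
    using assms by (intro sum_le_suminf summable_exp_generic) auto
  hence "x ^ m /\<^sub>R fact m \<le> exp x" by (simp add: exp_def)
  thus ?thesis by (simp add: field_simps)
qed

text \<open>Compactness of the circle supplies the boundedness without which the supremum would
  carry no information.\<close>

lemma norm_le_max_modulus:
  assumes "continuous_on UNIV f" "norm z = r"
  shows "norm (f z) \<le> max_modulus r f"
proof -
  have "compact ((\<lambda>z. norm (f z)) ` sphere 0 r)"
    by (intro compact_continuous_image continuous_on_norm continuous_on_subset[OF assms(1)]) auto
  hence "bdd_above ((\<lambda>z. norm (f z)) ` sphere 0 r)"
    by (intro bounded_imp_bdd_above compact_imp_bounded)
  thus ?thesis unfolding max_modulus_def using assms(2) by (intro cSUP_upper) auto
qed

lemma continuous_on_eval_fps_entire: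
  fixes F :: "complex fps"
  assumes "fps_conv_radius F = \<infinity>"
  shows "continuous_on UNIV (eval_fps F)"
  by (auto simp: continuous_on_eq_continuous_within assms intro!: continuous_eval_fps)

lemma fps_nth_max_modulus_le:
  fixes F :: "complex fps"
  assumes F: "fps_conv_radius F = \<infinity>" and r: "r > 0"
  shows "norm (fps_nth F m) * r ^ m \<le> max_modulus r (eval_fps F)"
proof -
  have cont: "continuous_on UNIV (eval_fps F)" by (rule continuous_on_eval_fps_entire[OF F])
  have "norm ((deriv ^^ m) (eval_fps F) 0) \<le> fact m * max_modulus r (eval_fps F) / r ^ m"
  proof (rule Cauchy_inequality)
    show "eval_fps F holomorphic_on ball 0 r"
      by (intro holomorphic_on_eval_fps) (auto simp: F)
    show "continuous_on (cball 0 r) (eval_fps F)"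
      by (rule continuous_on_subset[OF cont]) auto
  qed (use r norm_le_max_modulus[OF cont] in auto)
  moreover have "fps_nth F m = (deriv ^^ m) (eval_fps F) 0 / fact m"
    by (intro fps_nth_fps_expansion eval_fps_has_fps_expansion) (simp add: F)
  hence "norm ((deriv ^^ m) (eval_fps F) 0) = fact m * norm (fps_nth F m)"
    by (simp add: norm_divide)
  ultimately show ?thesis using r by (simp add: field_simps)
qed

text \<open>
  The terms of the series are at most \<open>2 ^ - m\<close> times
  \<open>((2 B r) powr (1 / q)) ^ m / fact m\<close> raised to the power \<open>q\<close>, hence at most
  \<open>2 ^ - m\<close> times \<open>exp (q (2 B r) powr (1 / q))\<close>.
\<close>

lemma entire_order_le:
  fixes F :: "complex fps"
  assumes F: "fps_conv_radius F = \<infinity>" and q: "q > 0" and A: "A > 0" and B: "B > 0"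
    and le: "\<And>m. norm (fps_nth F m) * fact m powr q \<le> A * B ^ m"
    and nonconst: "k \<ge> 1" "fps_nth F k \<noteq> 0"
  shows "entire_order (eval_fps F) \<le> ereal (1 / q)"
proof -
  define M where "M = (\<lambda>r. max_modulus r (eval_fps F))"
  have up: "M r \<le> 2 * A * exp (q * (2 * B * r) powr (1 / q))" if r: "r > 0" for r
    unfolding M_def max_modulus_def
  proof (rule cSUP_least)
    show "sphere (0::complex) r \<noteq> {}" using r by simp
    fix z :: complex assume "z \<in> sphere 0 r"
    hence z: "norm z = r" by simp
    define E where "E = exp (q * (2 * B * r) powr (1 / q))"
    have term_le: "norm (fps_nth F m * z ^ m) \<le> A * E * (1 / 2) ^ m" for m
    proof -
      have "(2 * B * r) ^ m = (((2 * B * r) powr (1 / q)) ^ m) powr q"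
        using r B q by (simp add: powr_powr powr_realpow[symmetric] mult.commute)
      also have "\<dots> \<le> (fact m * exp ((2 * B * r) powr (1 / q))) powr q"
        using r B q by (intro powr_mono2 power_le_fact_exp) auto
      also have "\<dots> = fact m powr q * E"
        by (simp add: powr_mult E_def exp_powr_real mult.commute)
      finally have *: "(2 * B * r) ^ m \<le> fact m powr q * E" .
      have "norm (fps_nth F m * z ^ m) * fact m powr q = (norm (fps_nth F m) * fact m powr q) * r ^ m"
        by (simp add: norm_mult norm_power z mult_ac)
      also have "\<dots> \<le> A * B ^ m * r ^ m"
        using le[of m] r by (intro mult_right_mono) auto
      also have "\<dots> = A * (1 / 2) ^ m * (2 * B * r) ^ m"
        by (simp add: power_mult_distrib[symmetric])
      also have "\<dots> \<le> A * (1 / 2) ^ m * (fact m powr q * E)"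
        using * A by (intro mult_left_mono) auto
      also have "\<dots> = A * E * (1 / 2) ^ m * fact m powr q" by (simp add: mult_ac)
      finally show ?thesis by (rule mult_right_le_imp_le) simp
    qed
    have "(\<lambda>m. A * E * (1 / 2) ^ m) sums (A * E * (1 / (1 - 1 / 2)))"
      by (intro sums_mult geometric_sums) simp
    hence S: "(\<lambda>m. A * E * (1 / 2) ^ m) sums (2 * A * E)" by (simp add: mult_ac)
    have "norm (\<Sum>m. fps_nth F m * z ^ m) \<le> (\<Sum>m. A * E * (1 / 2) ^ m)"
      by (rule norm_suminf_le[OF term_le sums_summable[OF S]])
    also have "\<dots> = 2 * A * E" using S by (rule sums_unique[symmetric])
    finally show "norm (eval_fps F z) \<le> 2 * A * exp (q * (2 * B * r) powr (1 / q))"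
      by (simp add: eval_fps_def E_def)
  qed
  \<comment> \<open>A nonzero coefficient of positive index makes \<open>M r\<close> at least
    \<open>a * r\<close>, eventually above e, so both logarithms are monotone where they are
    used.\<close>
  define a where "a = norm (fps_nth F k)"
  have a: "a > 0" using nonconst by (simp add: a_def)
  have "filterlim (\<lambda>r. a * r) at_top at_top" using a by real_asymp
  hence "eventually (\<lambda>r. exp 1 < a * r) at_top"
    by (simp add: filterlim_at_top_dense)
  hence "eventually (\<lambda>r. ereal (ln (ln (M r)) / ln r) \<le>
            ereal (ln (ln (2 * A * exp (q * (2 * B * r) powr (1 / q)))) / ln r)) at_top"
    using eventually_gt_at_top[of "1::real"]
  proof eventually_elim
    case (elim r)
    have "a * r \<le> a * r ^ k" using elim nonconst(1) a by (intro mult_left_mono self_le_power) auto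
    also have "\<dots> \<le> M r" unfolding a_def M_def using elim by (intro fps_nth_max_modulus_le F) auto
    finally have M: "exp 1 < M r" using elim by linarith
    hence M0: "M r > 0" by (rule less_trans[OF exp_gt_zero])
    have "ln (exp 1) < ln (M r)" using M M0 by (subst ln_less_cancel_iff) auto
    hence "ln (M r) > 0" by simp
    moreover have "ln (M r) \<le> ln (2 * A * exp (q * (2 * B * r) powr (1 / q)))"
      using up[of r] elim M0 by (intro ln_mono) auto
    ultimately have "ln (ln (M r)) \<le> ln (ln (2 * A * exp (q * (2 * B * r) powr (1 / q))))"
      by (subst ln_le_cancel_iff) auto
    thus ?case using elim by (simp add: divide_right_mono)
  qed
  hence "entire_order (eval_fps F) \<le>
     Limsup at_top (\<lambda>r. ereal (ln (ln (2 * A * exp (q * (2 * B * r) powr (1 / q)))) / ln r))"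
    unfolding entire_order_def M_def by (rule Limsup_mono)
  also have "((\<lambda>r. ln (ln (2 * A * exp (q * (2 * B * r) powr (1 / q)))) / ln r) \<longlongrightarrow> 1 / q) at_top"
    using A B q by real_asymp
  hence "Limsup at_top (\<lambda>r. ereal (ln (ln (2 * A * exp (q * (2 * B * r) powr (1 / q)))) / ln r)) = ereal (1 / q)"
    by (intro lim_imp_Limsup) auto
  finally show ?thesis .
qed

text \<open>For \<sigma> strictly between the order and 1/q, eventually M(r) \<le> exp(r^\<sigma>).
  Cauchy's estimate at r = m^(1/\<sigma>) and m! \<le> m^m then allow every \<tau> < 1/\<sigma>; the
  midpoint of q and 1/\<sigma> is taken.\<close>

lemma coeff_decay_of_entire_order:
  fixes F :: "complex fps"
  assumes F: "fps_conv_radius F = \<infinity>" and q: "q > 0"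
    and less: "entire_order (eval_fps F) < ereal (1 / q)"
  shows "\<exists>\<tau>>q. \<exists>A. \<forall>m. norm (fps_nth F m) * fact m powr \<tau> \<le> A"
proof -
  define M where "M = (\<lambda>r. max_modulus r (eval_fps F))"
  \<comment> \<open>The maximum with 0 ensures that \<sigma> is positive.\<close>
  have "max (entire_order (eval_fps F)) 0 < ereal (1 / q)" using less q by simp
  from ereal_dense2[OF this] obtain \<sigma>
    where "max (entire_order (eval_fps F)) 0 < ereal \<sigma>" "ereal \<sigma> < ereal (1 / q)" by blast
  hence \<sigma>: "entire_order (eval_fps F) < ereal \<sigma>" "\<sigma> > 0" "\<sigma> < 1 / q" by auto
  define \<tau> where "\<tau> = (q + 1 / \<sigma>) / 2"
  have "q < 1 / \<sigma>" using \<sigma> q by (simp add: field_simps)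
  hence \<tau>: "q < \<tau>" "\<tau> < 1 / \<sigma>" by (auto simp: \<tau>_def field_simps)
  have "eventually (\<lambda>r. ereal (ln (ln (M r)) / ln r) < ereal \<sigma>) at_top"
    using \<sigma>(1) unfolding entire_order_def M_def by (rule Limsup_lessD)
  hence "eventually (\<lambda>r. M r \<le> exp (r powr \<sigma>)) at_top"
    using eventually_gt_at_top[of "1::real"]
  proof eventually_elim
    case (elim r)
    have M0: "M r \<ge> 0"
      using fps_nth_max_modulus_le[OF F, of r 0] elim norm_ge_zero[of "fps_nth F 0"]
      unfolding M_def power_0 mult_1_right by linarith
    show ?case
    \<comment> \<open>For \<open>M r \<le> 1\<close> the iterated logarithm carries no information,
      but the bound is immediate.\<close>
    proof (cases "M r \<le> 1")
      case True
      have "1 \<le> exp (r powr \<sigma>)" by simp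
      with True show ?thesis by linarith
    next
      case False
      hence l: "ln (M r) > 0" by simp
      have "ln (ln (M r)) < \<sigma> * ln r" using elim by (simp add: field_simps)
      hence "exp (ln (ln (M r))) < exp (\<sigma> * ln r)" by (simp only: exp_less_cancel_iff)
      hence "ln (M r) < r powr \<sigma>" using l elim by (simp add: powr_def)
      hence "exp (ln (M r)) < exp (r powr \<sigma>)" by (simp only: exp_less_cancel_iff)
      thus ?thesis using False by simp
    qed
  qed
  then obtain R where R: "\<And>r. r \<ge> R \<Longrightarrow> M r \<le> exp (r powr \<sigma>)"
    by (auto simp: eventually_at_top_linorder)
  have "eventually (\<lambda>m::nat. real m powr (1 / \<sigma>) \<ge> R) at_top"
  proof -
    have "filterlim (\<lambda>m::nat. real m powr (1 / \<sigma>)) at_top at_top"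
      using \<sigma>(2) by real_asymp
    thus ?thesis by (simp add: filterlim_at_top)
  qed
  moreover have "eventually (\<lambda>m::nat. exp 1 * real m powr (\<tau> - 1 / \<sigma>) \<le> 1) at_top"
  proof -
    have "\<tau> - 1 / \<sigma> < 0" using \<tau> by simp
    hence "((\<lambda>m::nat. exp 1 * real m powr (\<tau> - 1 / \<sigma>)) \<longlongrightarrow> 0) at_top" by real_asymp
    from order_tendstoD(2)[OF this, of 1] show ?thesis by (auto elim: eventually_mono)
  qed
  ultimately have "eventually (\<lambda>m. norm (fps_nth F m) * fact m powr \<tau> \<le> 1) at_top"
    using eventually_gt_at_top[of "0::nat"]
  proof eventually_elim
    case (elim m)
    \<comment> \<open>With this radius r^\<sigma> = m, so the growth bound becomes e^m.\<close>
    define r where "r = real m powr (1 / \<sigma>)"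
    have r: "r > 0" using elim by (simp add: r_def)
    have "r ^ m = (real m powr real m) powr (1 / \<sigma>)"
      using elim by (simp add: r_def powr_powr mult.commute flip: powr_realpow)
    have "norm (fps_nth F m) * r ^ m \<le> M r"
      unfolding M_def by (rule fps_nth_max_modulus_le[OF F r])
    also have "\<dots> \<le> exp (r powr \<sigma>)" using elim by (intro R) (simp add: r_def)
    also have "r powr \<sigma> = real m" using elim \<sigma> by (simp add: r_def powr_powr)
    finally have 1: "norm (fps_nth F m) * r ^ m \<le> exp 1 ^ m"
      by (simp add: exp_of_nat_mult[symmetric])
    have "fact m powr \<tau> \<le> (real m ^ m) powr \<tau>"
      using fact_le_power[of m, where 'a = real] \<tau> q by (intro powr_mono2) auto
    also have "\<dots> = (real m powr \<tau>) ^ m"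
      using elim by (simp add: powr_powr mult.commute flip: powr_realpow)
    also have "real m powr \<tau> = r * real m powr (\<tau> - 1 / \<sigma>)"
      unfolding r_def by (simp flip: powr_add)
    finally have "norm (fps_nth F m) * fact m powr \<tau> \<le> norm (fps_nth F m) * (r * real m powr (\<tau> - 1 / \<sigma>)) ^ m"
      by (intro mult_left_mono) auto
    also have "\<dots> = (norm (fps_nth F m) * r ^ m) * (real m powr (\<tau> - 1 / \<sigma>)) ^ m"
      by (simp add: power_mult_distrib)
    also have "\<dots> \<le> exp 1 ^ m * (real m powr (\<tau> - 1 / \<sigma>)) ^ m"
      using 1 by (intro mult_right_mono) auto
    also have "\<dots> = (exp 1 * real m powr (\<tau> - 1 / \<sigma>)) ^ m"
      by (simp add: power_mult_distrib)
    also have "\<dots> \<le> 1" using elim by (intro power_le_one) auto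
    finally show ?case .
  qed
  then obtain N where N: "\<And>m. m \<ge> N \<Longrightarrow> norm (fps_nth F m) * fact m powr \<tau> \<le> 1"
    by (auto simp: eventually_at_top_linorder)
  have "norm (fps_nth F m) * fact m powr \<tau> \<le> 1 + (\<Sum>k<N. norm (fps_nth F k) * fact k powr \<tau>)" for m
  proof (cases "m < N")
    case True
    hence "norm (fps_nth F m) * fact m powr \<tau> \<le> (\<Sum>k<N. norm (fps_nth F k) * fact k powr \<tau>)"
      by (intro member_le_sum) auto
    thus ?thesis by simp
  next
    case False
    hence "norm (fps_nth F m) * fact m powr \<tau> \<le> 1" using N by simp
    moreover have "0 \<le> (\<Sum>k<N. norm (fps_nth F k) * fact k powr \<tau>)" by (intro sum_nonneg) auto
    ultimately show ?thesis by linarith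
  qed
  thus ?thesis using \<tau>(1) by blast
qed

subsection \<open>Coefficient estimates from the recurrence\<close>

text \<open>The term at \<open>p\<close> is minus the sum of the others. The bound on
  \<open>x t\<close> is asked only where \<open>c t\<close> is nonzero, since only there does the
  slope condition say anything.\<close>

lemma dominant_term_bound:
  fixes c x :: "'b \<Rightarrow> 'a :: real_normed_field"
  assumes "finite T" "p \<in> T" and 0: "(\<Sum>t\<in>T. c t * x t) = 0"
    and x: "\<And>t. t \<in> T - {p} \<Longrightarrow> c t \<noteq> 0 \<Longrightarrow> norm (x t) \<le> B" and B: "B \<ge> 0"
  shows "norm (c p * x p) \<le> (\<Sum>t\<in>T. norm (c t)) * B"
proof -
  have "c p * x p + (\<Sum>t\<in>T - {p}. c t * x t) = 0"
    using sum.remove[OF assms(1,2), of "\<lambda>t. c t * x t"] 0 by simp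
  hence "c p * x p = - (\<Sum>t\<in>T - {p}. c t * x t)" by (simp add: add_eq_0_iff)
  hence "norm (c p * x p) = norm (\<Sum>t\<in>T - {p}. c t * x t)" by simp
  also have "\<dots> \<le> (\<Sum>t\<in>T - {p}. norm (c t) * B)"
  proof (rule sum_norm_le)
    fix t assume "t \<in> T - {p}"
    thus "norm (c t * x t) \<le> norm (c t) * B"
      using x[of t] by (cases "c t = 0") (auto simp: norm_mult intro: mult_left_mono)
  qed
  also have "\<dots> \<le> (\<Sum>t\<in>T. norm (c t) * B)"
    using assms(1) B by (intro sum_mono2) auto
  finally show ?thesis by (simp add: sum_distrib_right)
qed

lemma fact_add_ge: "(real k + 1) ^ s * fact k \<le> fact (k + s)"
proof (induction s)
  case (Suc s)
  have "(real k + 1) ^ Suc s * fact k = (real k + 1) * ((real k + 1) ^ s * fact k)" by simp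
  also have "\<dots> \<le> (real (k + s) + 1) * fact (k + s)"
    using Suc by (intro mult_mono) auto
  finally show ?case by (simp add: add_ac)
qed auto

lemma fact_add_le: "fact (k + s) \<le> real (k + s) ^ s * fact k"
proof (induction s)
  case (Suc s)
  have "fact (k + Suc s) = (real (k + Suc s)) * fact (k + s)" by simp
  also have "\<dots> \<le> real (k + Suc s) * (real (k + s) ^ s * fact k)"
    using Suc by (intro mult_left_mono) auto
  also have "\<dots> \<le> real (k + Suc s) * (real (k + Suc s) ^ s * fact k)"
    by (intro mult_left_mono mult_right_mono power_mono) auto
  finally show ?case by (simp add: mult.assoc)
qed auto

text \<open>Each step costs a factor \<open>K\<close>. Taking \<open>B\<close> at least 1 makes the
  bound increasing, so the one at m - 1 covers all smaller indices; \<open>A\<close> covers the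
  initial segment.\<close>

lemma exponential_bound_of_recursive_bound:
  fixes w :: "nat \<Rightarrow> real"
  assumes w: "\<And>m. w m \<ge> 0" and b: "b \<ge> 1"
    and step: "\<And>N M. N \<ge> b \<Longrightarrow> M \<ge> 0 \<Longrightarrow> (\<And>m. m < N \<Longrightarrow> w m \<le> M) \<Longrightarrow> w N \<le> K * M"
  shows "\<exists>A>0. \<exists>B>0. \<forall>m. w m \<le> A * B ^ m"
proof -
  define A where "A = 1 + (\<Sum>m<b. w m)"
  define B where "B = max K 1"
  have A: "A > 0" unfolding A_def using w by (intro add_pos_nonneg sum_nonneg) auto
  have B: "B \<ge> 1" "K \<le> B" by (auto simp: B_def)
  have "w m \<le> A * B ^ m" for m
  proof (induction m rule: less_induct)
    case (less m)
    show ?case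
    proof (cases "m < b")
      case True
      hence "w m \<le> (\<Sum>m<b. w m)" using w by (intro member_le_sum) auto
      hence "w m \<le> A" by (simp add: A_def)
      also have "A \<le> A * B ^ m" using A B by simp
      finally show ?thesis .
    next
      case False
      have "w k \<le> A * B ^ (m - 1)" if "k < m" for k
      proof -
        have "w k \<le> A * B ^ k" by (rule less.IH[OF that])
        also have "\<dots> \<le> A * B ^ (m - 1)"
          using A B that by (intro mult_left_mono power_increasing) auto
        finally show ?thesis .
      qed
      hence "w m \<le> K * (A * B ^ (m - 1))" using False A B by (intro step) auto
      also have "\<dots> \<le> B * (A * B ^ (m - 1))" using A B by (intro mult_right_mono) auto
      also have "\<dots> = A * B ^ m" using False b by (cases m) auto
      finally show ?thesis .
    qed
  qed
  thus ?thesis using A B by (intro exI[of _ A] conjI exI[of _ B]) auto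
qed

text \<open>Beyond some \<open>K\<close> the factor is below 1/2, so the bound on the whole tail can
  be halved repeatedly and the tail vanishes.\<close>

lemma vanishes_of_contraction:
  fixes a :: "nat \<Rightarrow> real"
  assumes a: "\<And>k. a k \<ge> 0" "\<And>k. a k \<le> A" and \<delta>: "\<delta> > 0"
    and step: "\<And>k M. M \<ge> 0 \<Longrightarrow> (\<And>m. m > k \<Longrightarrow> a m \<le> M) \<Longrightarrow> a k \<le> C * (real k + 1) powr (- \<delta>) * M"
  shows "a k = 0"
proof -
  have "((\<lambda>k::nat. C * (real k + 1) powr (- \<delta>)) \<longlongrightarrow> 0) at_top"
    using \<delta> by real_asymp
  from order_tendstoD(2)[OF this, of "1 / 2"]
  obtain K where K: "\<And>k. k \<ge> K \<Longrightarrow> C * (real k + 1) powr (- \<delta>) < 1 / 2"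
    by (auto simp: eventually_at_top_linorder)
  have A: "A \<ge> 0" using a[of 0] by linarith
  have "a k \<le> A * (1 / 2) ^ i" if "k \<ge> K" for i k
    using that
  proof (induction i arbitrary: k)
    case (Suc i)
    have "a k \<le> C * (real k + 1) powr (- \<delta>) * (A * (1 / 2) ^ i)"
      using Suc A by (intro step) auto
    also have "\<dots> \<le> 1 / 2 * (A * (1 / 2) ^ i)"
      using K[of k] Suc A by (intro mult_right_mono) auto
    finally show ?case by simp
  qed (use a in auto)
  moreover have "(\<lambda>i. A * (1 / 2) ^ i) \<longlonglongrightarrow> A * 0"
    by (intro tendsto_mult_left LIMSEQ_power_zero) simp
  ultimately have "a k \<le> A * 0" if "k \<ge> K" for k
    using that by (intro LIMSEQ_le_const) auto
  hence ge: "a k = 0" if "k \<ge> K" for k using a(1)[of k] that by (simp add: order.antisym)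
  \<comment> \<open>A vanishing tail permits \<open>M = 0\<close> in the step, which carries the
    zeros down to index 0; \<open>i\<close> bounds the distance below \<open>K\<close>.\<close>
  have "\<forall>k. k + i \<ge> K \<longrightarrow> a k = 0" for i
  proof (induction i)
    case (Suc i)
    show ?case
    proof (intro allI impI)
      fix k assume "K \<le> k + Suc i"
      hence "a k \<le> C * (real k + 1) powr (- \<delta>) * 0"
        using Suc by (intro step) auto
      thus "a k = 0" using a(1)[of k] by simp
    qed
  qed (use ge in auto)
  from this[of K] show ?thesis by simp
qed

text \<open>The purely arithmetic side of the problem. The condition \<open>slope\<close> is of
  Newton polygon type: all (j, i) with nonzero coefficient lie on or below the line from (0, deg Q
  0) to (n, 0).\<close>

locale gamma_recurrence =
  fixes \<alpha> d q :: real and n :: nat and Q :: "nat \<Rightarrow> complex poly" and u :: "nat \<Rightarrow> complex"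
  assumes \<alpha>: "\<alpha> > 0" and n: "n \<ge> 1" and Q0: "Q 0 \<noteq> 0" and Qn: "Q n = 1"
    and d_eq: "d = real (degree (Q 0)) / real n"
    and q_eq: "q = \<alpha> / (1 + d)"
    and slope: "\<And>j i. j \<le> n \<Longrightarrow> coeff (Q j) i \<noteq> 0 \<Longrightarrow> real i \<le> d * (real n - real j)"
    and recurrence: "\<And>m. (\<Sum>j\<le>n. \<Sum>i\<le>m. coeff (Q j) i * (of_real (Gamma (\<alpha> * real (m - i + j) + 1) / Gamma (\<alpha> * real (m - i) + 1)) *
            u (m - i + j))) = 0"
begin

text \<open>The factor with which the j-th Caputo iterate takes coefficient k + j to coefficient
  k.\<close>

definition R :: "nat \<Rightarrow> nat \<Rightarrow> real" where
  "R j k = Gamma (\<alpha> * real (k + j) + 1) / Gamma (\<alpha> * real k + 1)"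

lemma d_nonneg: "d \<ge> 0" by (simp add: d_eq)

lemma q_pos: "q > 0" using \<alpha> d_nonneg by (simp add: q_eq)

text \<open>This balance converts slope bounds on index shifts into the exponents of the Gamma
  quotients.\<close>

lemma q_mult: "(1 + d) * q = \<alpha>" using d_nonneg by (simp add: q_eq)

lemma Gamma_pos: "Gamma (\<alpha> * real k + 1) > 0"
  using \<alpha> by (intro Gamma_real_pos add_nonneg_pos) auto

lemma R_pos: "R j k > 0"
  unfolding R_def by (intro divide_pos_pos Gamma_pos)

lemma R_0: "R 0 k = 1"
proof -
  have "Gamma (\<alpha> * real k + 1) \<noteq> 0" by (metis Gamma_pos less_irrefl)
  thus ?thesis by (simp add: R_def)
qed

lemma R_upper: "R j k \<le> (\<alpha> * real (k + j) + 1) powr (\<alpha> * real j)"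
proof -
  have "\<alpha> * real k + 1 > 0" using \<alpha> by (intro add_nonneg_pos) auto
  from Gamma_ratio_upper[OF this, of "\<alpha> * real j"] show ?thesis
    using \<alpha> by (simp add: R_def algebra_simps)
qed

lemma R_lower: "k \<ge> 1 \<Longrightarrow> (\<alpha> * real k) powr (\<alpha> * real j) \<le> R j k"
  using Gamma_ratio_lower[of "\<alpha> * real k + 1" "\<alpha> * real j"] \<alpha>
  by (simp add: R_def algebra_simps)

lemma coeff_index_le:
  assumes "j \<le> n" "coeff (Q j) i \<noteq> 0"
  shows "i \<le> degree (Q 0)"
proof -
  have "real i \<le> d * (real n - real j)" by (rule slope[OF assms])
  also have "\<dots> \<le> d * real n" using d_nonneg by (intro mult_left_mono) auto
  also have "\<dots> = real (degree (Q 0))" using n by (simp add: d_eq)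
  finally show ?thesis by simp
qed

definition T :: "(nat \<times> nat) set" where "T = {..n} \<times> {..degree (Q 0)}"

definition cf :: "nat \<times> nat \<Rightarrow> complex" where "cf t = coeff (Q (fst t)) (snd t)"

definition W :: real where "W = (\<Sum>t\<in>T. norm (cf t))"

text \<open>Summing over a finite set independent of m makes \<open>W\<close> a uniform constant.
  The conditional switches off the pairs with i > m.\<close>

lemma recurrence_pairs:
  "(\<Sum>t\<in>T. cf t *
      (if snd t \<le> m then of_real (R (fst t) (m - snd t)) * u (m - snd t + fst t) else 0)) = 0"
proof -
  let ?g = "\<lambda>j i. coeff (Q j) i * (of_real (R j (m - i)) * u (m - i + j))"
  have "(\<Sum>i\<le>degree (Q 0). coeff (Q j) i * (if i \<le> m then of_real (R j (m - i)) * u (m - i + j) else 0))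
      = (\<Sum>i\<le>m. ?g j i)" if "j \<le> n" for j
  proof -
    have "(\<Sum>i\<le>degree (Q 0). coeff (Q j) i * (if i \<le> m then of_real (R j (m - i)) * u (m - i + j) else 0))
       = (\<Sum>i\<in>{..degree (Q 0)} \<inter> {..m}. ?g j i)"
      by (intro sum.mono_neutral_cong_right) auto
    also have "\<dots> = (\<Sum>i\<le>m. ?g j i)"
    proof (intro sum.mono_neutral_left ballI)
      fix i assume "i \<in> {..m} - {..degree (Q 0)} \<inter> {..m}"
      hence "coeff (Q j) i = 0" using coeff_index_le[OF that, of i] by auto
      thus "?g j i = 0" by simp
    qed auto
    finally show ?thesis .
  qed
  note inner = this
  have "(\<Sum>j\<le>n. \<Sum>i\<le>degree (Q 0). coeff (Q j) i * (if i \<le> m then of_real (R j (m - i)) * u (m - i + j) else 0))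
      = (\<Sum>j\<le>n. \<Sum>i\<le>m. ?g j i)"
    by (rule sum.cong[OF refl]) (simp only: inner atMost_iff)
  also have "\<dots> = 0" using recurrence[of m] by (simp only: R_def)
  finally show ?thesis
    by (simp add: T_def cf_def sum.cartesian_product case_prod_unfold)
qed

text \<open>
  The slope condition on \<open>Q j\<close> makes the growth \<open>(m + n) powr (s q)\<close> of the factorials, where
  \<open>s = n - j + i\<close>, compensate exactly the quotient of the Gamma ratios.
\<close>

lemma coeff_growth_step:
  assumes m: "m \<ge> 1" and M: "M \<ge> 0" "\<And>k. k < m + n \<Longrightarrow> norm (u k) * fact k powr q \<le> M"
  shows "norm (u (m + n)) * fact (m + n) powr q \<le> W * ((\<alpha> + 1) * (1 + real n) / \<alpha>) powr (\<alpha> * real n) * M"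
proof -
  define K where "K = ((\<alpha> + 1) * (1 + real n) / \<alpha>) powr (\<alpha> * real n)"
  define B where "B = K * R n m * M / fact (m + n) powr q"
  have K: "K \<ge> 0" by (simp add: K_def)
  have B: "B \<ge> 0" unfolding B_def using K R_pos[of n m] M by simp
  define x where "x = (\<lambda>t. if snd t \<le> m then of_real (R (fst t) (m - snd t)) * u (m - snd t + fst t) else 0)"
  have "norm (cf (n, 0) * x (n, 0)) \<le> W * B"
    unfolding W_def
  proof (rule dominant_term_bound)
    show "finite T" "(n, 0) \<in> T" by (auto simp: T_def)
    show "(\<Sum>t\<in>T. cf t * x t) = 0"
      unfolding x_def by (rule recurrence_pairs)
    show "B \<ge> 0" by fact
    fix t assume t: "t \<in> T - {(n, 0)}" "cf t \<noteq> 0"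
    obtain j i where ji: "t = (j, i)" by (cases t)
    have j: "j \<le> n" using t by (auto simp: ji T_def)
    have c: "coeff (Q j) i \<noteq> 0" using t by (simp add: ji cf_def)
    \<comment> \<open>As \<open>Q n = 1\<close>, the only pair with j = n is the isolated one. Hence
      j < n, and the index k below lies strictly under m + n.\<close>
    have jn: "j < n"
    proof (rule ccontr)
      assume "\<not> j < n"
      hence "j = n" using j by simp
      with c Qn have "i = 0" by (auto simp: coeff_1 split: if_splits)
      with \<open>j = n\<close> t show False by (simp add: ji)
    qed
    show "norm (x t) \<le> B"
    proof (cases "i \<le> m")
      case False
      thus ?thesis using B by (simp add: x_def ji)
    next
      case True
      define s where "s = n - j + i"
      define k where "k = m - i + j"
      have ks: "k + s = m + n" using True j by (simp add: k_def s_def)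
      \<comment> \<open>The slope condition gives s \<le> (n - j) (1 + d), and (1 + d) q =
        \<alpha>.\<close>
      have sq: "real s * q \<le> \<alpha> * (real n - real j)"
      proof -
        have "real s = (real n - real j) + real i" using j by (simp add: s_def of_nat_diff)
        also have "\<dots> \<le> (real n - real j) * (1 + d)" using slope[OF j c] by (simp add: algebra_simps)
        finally have "real s * q \<le> (real n - real j) * (1 + d) * q"
          using q_pos by (intro mult_right_mono) auto
        thus ?thesis by (simp add: mult.assoc q_mult mult.commute[of \<alpha>])
      qed
      have mn: "real (m + n) \<ge> 1" using m by simp
      have "fact (m + n) powr q \<le> (real (m + n) ^ s * fact k) powr q"
        using fact_add_le[of k s] q_pos unfolding ks by (intro powr_mono2) auto
      also have "\<dots> = real (m + n) powr (real s * q) * fact k powr q"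
        using mn by (simp add: powr_mult powr_powr flip: powr_realpow)
      also have "\<dots> \<le> real (m + n) powr (\<alpha> * (real n - real j)) * fact k powr q"
        using sq mn by (intro mult_right_mono powr_mono) auto
      finally have 1: "fact (m + n) powr q \<le> real (m + n) powr (\<alpha> * (real n - real j)) * fact k powr q" .
      have "R j (m - i) \<le> (\<alpha> * real k + 1) powr (\<alpha> * real j)"
        unfolding k_def by (rule R_upper)
      also have "\<dots> \<le> ((\<alpha> + 1) * real (m + n)) powr (\<alpha> * real j)"
      proof (rule powr_mono2)
        have "\<alpha> * real k \<le> \<alpha> * real (m + n)" using \<alpha> ks by (intro mult_left_mono) auto
        thus "\<alpha> * real k + 1 \<le> (\<alpha> + 1) * real (m + n)" using mn by (simp add: algebra_simps)
      qed (use \<alpha> in auto)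
      also have "\<dots> = (\<alpha> + 1) powr (\<alpha> * real j) * real (m + n) powr (\<alpha> * real j)"
        using \<alpha> by (simp add: powr_mult)
      also have "\<dots> \<le> (\<alpha> + 1) powr (\<alpha> * real n) * real (m + n) powr (\<alpha> * real j)"
        using \<alpha> j by (intro mult_right_mono powr_mono) auto
      finally have 2: "R j (m - i) \<le> \<dots>" .
      \<comment> \<open>The exponents \<alpha> (n - j) and \<alpha> j of m + n add up to \<alpha> n,
        the exponent in the lower bound for \<open>R n m\<close>.\<close>
      have "fact (m + n) powr q * R j (m - i) \<le> (real (m + n) powr (\<alpha> * (real n - real j)) * fact k powr q) *
              ((\<alpha> + 1) powr (\<alpha> * real n) * real (m + n) powr (\<alpha> * real j))"
        using R_pos[of j "m - i"] by (intro mult_mono 1 2) auto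
      also have "\<dots> = fact k powr q * ((\<alpha> + 1) powr (\<alpha> * real n) * real (m + n) powr (\<alpha> * real n))"
        by (simp add: algebra_simps flip: powr_add)
      also have "(\<alpha> + 1) powr (\<alpha> * real n) * real (m + n) powr (\<alpha> * real n)
          = ((\<alpha> + 1) * real (m + n)) powr (\<alpha> * real n)"
        using \<alpha> by (simp add: powr_mult)
      \<comment> \<open>For m \<ge> 1, m + n \<le> (1 + n) m; this produces the base \<alpha> m of
        \<open>R_lower\<close> and leaves the constant \<open>K\<close>.\<close>
      also have "\<dots> \<le> ((\<alpha> + 1) * (1 + real n) / \<alpha> * (\<alpha> * real m)) powr (\<alpha> * real n)"
      proof (rule powr_mono2)
        have "real n * 1 \<le> real n * real m" using m by (intro mult_left_mono) auto
        hence "real (m + n) \<le> (1 + real n) * real m" by (simp add: algebra_simps)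
        hence "(\<alpha> + 1) * real (m + n) \<le> (\<alpha> + 1) * ((1 + real n) * real m)"
          using \<alpha> by (intro mult_left_mono) auto
        thus "(\<alpha> + 1) * real (m + n) \<le> (\<alpha> + 1) * (1 + real n) / \<alpha> * (\<alpha> * real m)"
          using \<alpha> by simp
      qed (use \<alpha> in auto)
      also have "\<dots> = K * (\<alpha> * real m) powr (\<alpha> * real n)"
        unfolding K_def by (rule powr_mult)
      also have "\<dots> \<le> K * R n m"
        using K m by (intro mult_left_mono R_lower) auto
      finally have 3: "fact (m + n) powr q * R j (m - i) \<le> fact k powr q * (K * R n m)"
        by simp
      have "norm (x t) * fact (m + n) powr q = norm (u k) * (fact (m + n) powr q * R j (m - i))"
        using True R_pos[of j "m - i"] by (simp add: x_def ji norm_mult k_def)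
      also have "\<dots> \<le> norm (u k) * (fact k powr q * (K * R n m))"
        using 3 by (intro mult_left_mono) auto
      also have "\<dots> = (norm (u k) * fact k powr q) * (K * R n m)" by simp
      also have "\<dots> \<le> M * (K * R n m)"
        using ks jn K R_pos[of n m] by (intro mult_right_mono M) (auto simp: s_def)
      finally have "norm (x t) * fact (m + n) powr q \<le> M * (K * R n m)" .
      thus ?thesis by (simp add: B_def field_simps)
    qed
  qed
  hence "R n m * norm (u (m + n)) \<le> W * B"
    using R_pos[of n m] by (simp add: cf_def Qn x_def norm_mult)
  hence "R n m * (norm (u (m + n)) * fact (m + n) powr q) \<le> R n m * (W * K * M)"
    by (simp add: B_def field_simps)
  thus ?thesis using R_pos[of n m] by (simp add: K_def)
qed

text \<open>The threshold \<open>Suc n\<close> guarantees N - n \<ge> 1, as the growth step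
  requires.\<close>

lemma coeff_upper_bound: "\<exists>A>0. \<exists>B>0. \<forall>m. norm (u m) * fact m powr q \<le> A * B ^ m"
proof (rule exponential_bound_of_recursive_bound[where b = "Suc n"])
  fix N M assume "N \<ge> Suc n" "M \<ge> (0::real)" "\<And>k. k < N \<Longrightarrow> norm (u k) * fact k powr q \<le> M"
  thus "norm (u N) * fact N powr q \<le> W * ((\<alpha> + 1) * (1 + real n) / \<alpha>) powr (\<alpha> * real n) * M"
    using coeff_growth_step[of "N - n" M] by simp
qed auto

text \<open>
  Here the recurrence is solved for the term that comes from the leading coefficient of \<open>Q 0\<close>;
  by the slope condition all other terms have an index \<open>k + s\<close> with \<open>s \<ge> 1\<close>.
\<close>

lemma coeff_backward_step:
  assumes \<tau>: "\<tau> > q" and M: "M \<ge> 0" "\<And>m. m > k \<Longrightarrow> norm (u m) * fact m powr \<tau> \<le> M"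
  defines "L \<equiv> (\<alpha> + \<alpha> * (real (degree (Q 0)) + real n) + 1) powr (\<alpha> * real n)"
  shows "norm (u k) * fact k powr \<tau> \<le> W * L / norm (lead_coeff (Q 0)) * (real k + 1) powr (- (\<tau> - q)) * M"
proof -
  define e where "e = degree (Q 0)"
  \<comment> \<open>In the equation of index k + e the pair (0, e) contributes exactly
    \<open>u k\<close>, with Gamma factor \<open>R 0 k = 1\<close>.\<close>
  define m where "m = k + e"
  define B where "B = L * (real k + 1) powr (- (\<tau> - q)) * M / fact k powr \<tau>"
  have L: "L \<ge> 0" by (simp add: L_def)
  have B: "B \<ge> 0" unfolding B_def using L M by simp
  define x where "x = (\<lambda>t. if snd t \<le> m then of_real (R (fst t) (m - snd t)) * u (m - snd t + fst t) else 0)"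
  have "norm (cf (0, e) * x (0, e)) \<le> W * B"
    unfolding W_def
  proof (rule dominant_term_bound)
    show "finite T" "(0, e) \<in> T" by (auto simp: T_def e_def)
    show "(\<Sum>t\<in>T. cf t * x t) = 0"
      unfolding x_def by (rule recurrence_pairs)
    show "B \<ge> 0" by fact
    fix t assume t: "t \<in> T - {(0, e)}" "cf t \<noteq> 0"
    obtain j i where ji: "t = (j, i)" by (cases t)
    have j: "j \<le> n" using t by (auto simp: ji T_def)
    have c: "coeff (Q j) i \<noteq> 0" using t by (simp add: ji cf_def)
    have ie: "i \<le> e" using coeff_index_le[OF j c] by (simp add: e_def)
    define s where "s = e - i + j"
    have ks: "m - i + j = k + s" using ie by (simp add: m_def s_def)
    \<comment> \<open>For j = 0 the excluded pair forces i < e, so the shift is positive in every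
      case.\<close>
    have s: "s \<ge> 1" using ie t by (cases "j = 0") (auto simp: s_def ji)
    \<comment> \<open>Since d n = e, the slope condition reads j (1 + d) \<le> e - i + j = s;
      multiplying by q turns the left side into \<alpha> j.\<close>
    have jq: "\<alpha> * real j \<le> real s * q"
    proof -
      have "d * (real n - real j) = real e - d * real j"
        using n by (simp add: d_eq e_def field_simps)
      hence "real j * (1 + d) \<le> real s"
        using slope[OF j c] ie by (simp add: s_def of_nat_diff algebra_simps)
      hence "real j * (1 + d) * q \<le> real s * q"
        using q_pos by (intro mult_right_mono) auto
      thus ?thesis by (simp add: mult.assoc q_mult mult.commute[of \<alpha>])
    qed
    have "R j (m - i) \<le> (\<alpha> * real (k + s) + 1) powr (\<alpha> * real j)"
      using R_upper[of j "m - i"] unfolding ks .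
    also have "\<dots> \<le> ((\<alpha> + \<alpha> * (real e + real n) + 1) * (real k + 1)) powr (\<alpha> * real j)"
    proof (rule powr_mono2)
      have "\<alpha> * real s \<le> \<alpha> * (real e + real n)" using \<alpha> j by (intro mult_left_mono) (auto simp: s_def)
      moreover have "0 \<le> \<alpha> * (real e + real n) * real k" using \<alpha> by simp
      moreover have "(\<alpha> + \<alpha> * (real e + real n) + 1) * (real k + 1) =
          \<alpha> * real k + \<alpha> * (real e + real n) + 1 + (\<alpha> + real k + \<alpha> * (real e + real n) * real k)"
        by (simp add: algebra_simps)
      moreover have "\<alpha> * real (k + s) = \<alpha> * real k + \<alpha> * real s" by (simp add: algebra_simps)
      ultimately show "\<alpha> * real (k + s) + 1 \<le> (\<alpha> + \<alpha> * (real e + real n) + 1) * (real k + 1)"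
        using \<alpha> by linarith
    qed (use \<alpha> in auto)
    also have "\<dots> = (\<alpha> + \<alpha> * (real e + real n) + 1) powr (\<alpha> * real j) * (real k + 1) powr (\<alpha> * real j)"
      by (rule powr_mult)
    also have "\<dots> \<le> L * (real k + 1) powr (real s * q)"
    proof (rule mult_mono)
      show "(\<alpha> + \<alpha> * (real e + real n) + 1) powr (\<alpha> * real j) \<le> L"
        unfolding L_def e_def[symmetric] using \<alpha> j by (intro powr_mono mult_left_mono) auto
      show "(real k + 1) powr (\<alpha> * real j) \<le> (real k + 1) powr (real s * q)"
        using jq by (intro powr_mono) auto
    qed (use L in auto)
    finally have 1: "R j (m - i) \<le> L * (real k + 1) powr (real s * q)" .
    have "(real k + 1) powr (real s * \<tau>) * fact k powr \<tau> = ((real k + 1) ^ s * fact k) powr \<tau>"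
      by (simp add: powr_mult powr_powr flip: powr_realpow)
    also have "\<dots> \<le> fact (k + s) powr \<tau>"
      using fact_add_ge[of k s] \<tau> q_pos by (intro powr_mono2) auto
    finally have 2: "(real k + 1) powr (real s * \<tau>) * fact k powr \<tau> \<le> fact (k + s) powr \<tau>" .
    have "norm (x t) * fact k powr \<tau> \<le> R j (m - i) * (norm (u (k + s)) * fact k powr \<tau>)"
      using R_pos[of j "m - i"] by (auto simp: x_def ji norm_mult ks)
    also have "\<dots> \<le> (L * (real k + 1) powr (real s * q)) * (norm (u (k + s)) * fact k powr \<tau>)"
      using 1 by (intro mult_right_mono) auto
    also have "(real k + 1) powr (real s * q) = (real k + 1) powr (- (real s * (\<tau> - q))) * (real k + 1) powr (real s * \<tau>)"
      by (simp add: algebra_simps flip: powr_add)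
    also have "(L * \<dots>) * (norm (u (k + s)) * fact k powr \<tau>) =
       L * (real k + 1) powr (- (real s * (\<tau> - q))) * (norm (u (k + s)) * ((real k + 1) powr (real s * \<tau>) * fact k powr \<tau>))"
      by (simp add: mult_ac)
    also have "\<dots> \<le> L * (real k + 1) powr (- (real s * (\<tau> - q))) * (norm (u (k + s)) * fact (k + s) powr \<tau>)"
      using 2 L by (intro mult_left_mono) auto
    \<comment> \<open>As s \<ge> 1, every shift gains at least the factor of a shift by one.\<close>
    also have "\<dots> \<le> L * (real k + 1) powr (- (\<tau> - q)) * M"
    proof (intro mult_mono powr_mono M)
      have "1 * (\<tau> - q) \<le> real s * (\<tau> - q)" using s \<tau> by (intro mult_right_mono) auto
      thus "- (real s * (\<tau> - q)) \<le> - (\<tau> - q)" by simp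
    qed (use L s in auto)
    finally show "norm (x t) \<le> B"
      by (simp add: B_def field_simps)
  qed
  hence "norm (lead_coeff (Q 0)) * norm (u k) \<le> W * B"
    by (simp add: cf_def x_def norm_mult R_0 e_def m_def)
  moreover have "norm (lead_coeff (Q 0)) > 0" using Q0 by simp
  ultimately show ?thesis by (simp add: B_def field_simps)
qed

lemma vanishes_of_fast_decay:
  assumes "\<tau> > q" "\<And>m. norm (u m) * fact m powr \<tau> \<le> A"
  shows "u m = 0"
proof -
  have "norm (u m) * fact m powr \<tau> = 0"
    by (rule vanishes_of_contraction[where \<delta> = "\<tau> - q" and A = A,
          OF _ assms(2) _ coeff_backward_step[OF assms(1)]]) (use assms in auto)
  thus ?thesis by simp
qed

end

section \<open>From the degree condition to the order of the solutions\<close>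

text \<open>A nonzero coefficient excludes degree -\<infinity>, so the comparison with the maximum
  becomes an inequality between reals.\<close>

lemma slope_of_Max_ext_degree:
  fixes P :: "nat \<Rightarrow> complex poly"
  assumes n: "n \<ge> 1" and P0: "P 0 \<noteq> 0"
    and Max: "Max ((\<lambda>k. ext_degree (P k) / ereal (real (n - k))) ` {0..n - 1})
           = ext_degree (P 0) / ereal (real n)"
    and j: "j < n" and i: "coeff (P j) i \<noteq> 0"
  shows "real i \<le> real (degree (P 0)) / real n * (real n - real j)"
proof -
  have "ext_degree (P j) / ereal (real (n - j)) \<le> Max ((\<lambda>k. ext_degree (P k) / ereal (real (n - k))) ` {0..n - 1})"
    using j by (intro Max_ge) auto
  moreover have "P j \<noteq> 0" using i by auto
  ultimately have "real (degree (P j)) / real (n - j) \<le> real (degree (P 0)) / real n"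
    unfolding Max using P0 n j by (simp add: ext_degree_def)
  hence "real (degree (P j)) \<le> real (degree (P 0)) / real n * real (n - j)"
    using j by (subst (asm) pos_divide_le_eq) auto
  moreover have "i \<le> degree (P j)" using i by (rule le_degree)
  ultimately show ?thesis using j by (simp add: of_nat_diff)
qed

theorem theorem4:
  fixes \<alpha> :: real and n :: nat
    and P :: "nat \<Rightarrow> complex poly" and p :: "nat \<Rightarrow> real \<Rightarrow> complex"
    and y :: "real \<Rightarrow> complex"
  assumes "\<alpha> > 0" and "n \<ge> 1"
    and "\<And>j x. j < n \<Longrightarrow> x \<ge> 0 \<Longrightarrow> p j x = poly (P j) (of_real (x powr \<alpha>))"
    and "\<exists>x\<ge>0. p 0 x \<noteq> 0"
    and "Max ((\<lambda>k. ext_degree (P k) / ereal (real (n - k))) ` {0..n - 1})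
           = ext_degree (P 0) / ereal (real n)"
    and "frac_analytic \<alpha> y" and "\<exists>t\<ge>0. y t \<noteq> 0"
    and "\<And>x. x \<ge> 0 \<Longrightarrow>
           (caputo_deriv \<alpha> ^^ n) y x + (\<Sum>j<n. p j x * (caputo_deriv \<alpha> ^^ j) y x) = 0"
  shows "\<exists>f. f holomorphic_on UNIV \<and> \<not> f constant_on UNIV \<and>
           (\<forall>t\<ge>0. y t = f (of_real (t powr \<alpha>))) \<and>
           entire_order f = ereal (1 / \<alpha> * (1 + real (degree (P 0)) / real n))"
proof -
  obtain u where u: "\<And>t. t \<ge> 0 \<Longrightarrow> (\<lambda>m. u m * of_real ((t powr \<alpha>) ^ m)) sums y t"
    using assms(6) by (auto simp: frac_analytic_def)
  define F :: "complex fps" where "F = Abs_fps u"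
  have F: "fps_conv_radius F = \<infinity>"
    unfolding fps_conv_radius_def
  proof (rule conv_radius_inftyI'[of 0])
    fix r :: real assume r: "r > 0"
    \<comment> \<open>The half-line point r^(1/\<alpha>) yields convergence at z = r, a point of
      modulus r.\<close>
    have "summable (\<lambda>m. u m * of_real (((r powr (1 / \<alpha>)) powr \<alpha>) ^ m))"
      using u[of "r powr (1 / \<alpha>)"] by (auto dest: sums_summable)
    thus "\<exists>z. norm z = r \<and> summable (\<lambda>m. fps_nth F m * z ^ m)"
      using r assms(1) by (intro exI[of _ "of_real r"]) (simp add: powr_powr F_def)
  qed
  have y: "y t = eval_fps F (of_real (t powr \<alpha>))" if "t \<ge> 0" for t
    using u[OF that] by (simp add: eval_fps_def F_def sums_iff)
  \<comment> \<open>The value 1 at n absorbs the leading term of the equation into the sum.\<close>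
  define Q where "Q = P(n := 1)"
  have Q: "Q 0 = P 0" "Q n = 1" "\<And>j. j < n \<Longrightarrow> Q j = P j" using assms(2) by (auto simp: Q_def)
  have P0: "P 0 \<noteq> 0" using assms(2,3,4) by fastforce
  have eq: "(\<Sum>j\<le>n. poly (Q j) (of_real (t powr \<alpha>)) * (caputo_deriv \<alpha> ^^ j) y t) = 0" if "t \<ge> 0" for t
  proof -
    have "(\<Sum>j\<le>n. poly (Q j) (of_real (t powr \<alpha>)) * (caputo_deriv \<alpha> ^^ j) y t) =
       (caputo_deriv \<alpha> ^^ n) y t + (\<Sum>j<n. p j t * (caputo_deriv \<alpha> ^^ j) y t)"
      using that assms(3) by (simp add: lessThan_Suc_atMost[symmetric] Q)
    thus ?thesis using assms(8)[OF that] by simp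
  qed
  define d where "d = real (degree (P 0)) / real n"
  define q where "q = \<alpha> / (1 + d)"
  interpret gamma_recurrence \<alpha> d q n Q "fps_nth F"
  proof
    show "\<alpha> > 0" "n \<ge> 1" by fact+
    show "real i \<le> d * (real n - real j)" if "j \<le> n" "coeff (Q j) i \<noteq> 0" for j i
    proof (cases "j = n")
      case True
      with that Q have "i = 0" by (auto simp: coeff_1 split: if_splits)
      with True show ?thesis by simp
    next
      case False
      thus ?thesis using slope_of_Max_ext_degree[of n P j i] that assms(2,5) P0
        by (simp add: Q d_def)
    qed
  qed (use P0 coefficient_recurrence[OF assms(1) F y eq] in \<open>simp_all add: Q d_def q_def\<close>)
  have not_zero: "\<exists>m. fps_nth F m \<noteq> 0"
  proof (rule ccontr)
    assume "\<nexists>m. fps_nth F m \<noteq> 0"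
    hence "F = 0" by (simp add: fps_eq_iff)
    with y assms(7) show False by auto
  qed
  \<comment> \<open>If only the constant coefficient survived, the fast decay bound would hold with
    exponent q + 1, and that coefficient would vanish too.\<close>
  have "\<exists>k\<ge>1. fps_nth F k \<noteq> 0"
  proof (rule ccontr)
    assume *: "\<not> (\<exists>k\<ge>1. fps_nth F k \<noteq> 0)"
    have "fps_nth F m = 0" for m
    proof (rule vanishes_of_fast_decay)
      show "q + 1 > q" by simp
      show "norm (fps_nth F k) * fact k powr (q + 1) \<le> norm (fps_nth F 0)" for k
        using * by (cases k) auto
    qed
    with not_zero show False by blast
  qed
  then obtain k where k: "k \<ge> 1" "fps_nth F k \<noteq> 0" by blast
  have "\<not> eval_fps F constant_on UNIV"
  proof
    assume "eval_fps F constant_on UNIV"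
    then obtain c where "\<And>z. eval_fps F z = c" by (auto simp: constant_on_def)
    hence "F - fps_const c = 0"
      using F fps_conv_radius_diff[of F "fps_const c"]
      by (intro eval_fps_eq_0_on_reals) (auto simp: eval_fps_diff)
    hence "fps_nth (F - fps_const c) k = 0" by simp
    with k show False by simp
  qed
  moreover have "entire_order (eval_fps F) = ereal (1 / q)"
  proof (rule antisym)
    obtain A B where "A > 0" "B > 0" "\<And>m. norm (fps_nth F m) * fact m powr q \<le> A * B ^ m"
      using coeff_upper_bound by blast
    thus "entire_order (eval_fps F) \<le> ereal (1 / q)"
      by (rule entire_order_le[OF F q_pos _ _ _ k])
    show "ereal (1 / q) \<le> entire_order (eval_fps F)"
    proof (rule ccontr)
      assume "\<not> ereal (1 / q) \<le> entire_order (eval_fps F)"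
      then obtain \<tau> A where "\<tau> > q" "\<And>m. norm (fps_nth F m) * fact m powr \<tau> \<le> A"
        using coeff_decay_of_entire_order[OF F q_pos] by (auto simp: not_le)
      hence "fps_nth F m = 0" for m by (rule vanishes_of_fast_decay)
      with not_zero show False by blast
    qed
  qed
  moreover have "1 / q = 1 / \<alpha> * (1 + real (degree (P 0)) / real n)"
    by (simp add: q_def d_def)
  moreover have "eval_fps F holomorphic_on UNIV"
    by (intro holomorphic_on_eval_fps) (auto simp: F)
  ultimately show ?thesis using y by (intro exI[of _ "eval_fps F"]) auto
qed

end
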